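(* For $\alpha\in\{0,1\}$ let $$H=\frac{p_1^2+p_2^2}{2}+E_1+E_2+\alpha\exp(-q_2),\qquad E_1=\exp\left(\frac{q_1}{\sqrt3}\right),\quad E_2=\exp\left(-\frac{\sqrt3}{2}q_1+\frac{q_2}{2}\right),$$ on $\mathbb R^4$ with coordinates $(q_1,q_2,p_1,p_2)$, and let $X=P\,dH$, where $P$ is the canonical Poisson bivector. Consider the invariance equation $\mathcal L_XP'=0$ in the space of bivector fields $P'$ whose entries are polynomials of degree at most two in $p_1,p_2$ with coefficients that are smooth functions of $(q_1,q_2)$. (i) For the open Toda lattice ($\alpha=0$) the solution of the invariance equation in this space is the three-parameter family $$P'=(a_1H+a_2)P+a_3\tilde P,\qquad a_1,a_2,a_3\in\mathbb R,$$ where $\tilde P$ is the bivector with entries $$\tilde P^{12}=\sqrt3\,p_2-5p_1,\quad \tilde P^{13}=\frac{p_2^2}{2}+\frac{5E_2}{2},\quad \tilde P^{14}=-\frac{p_1p_2}{2}-\frac{\sqrt3E_2}{2},$$ $$\tilde P^{23}=-\frac{p_1p_2}{2}-\frac{5\sqrt3E_1}{3}+\frac{5\sqrt3E_2}{2},\quad \tilde P^{24}=\frac{p_1^2}{2}-\frac{3E_2}{2}+E_1,$$ $$\tilde P^{34}=-\frac{E_2}{4}p_1+\frac{\sqrt3(2E_1-3E_2)}{12}p_2 .$$ (ii) For the periodic Toda lattice ($\alpha=1$) the solution of the invariance equation in this space depends only on two parameters: it is $$P'=(a_1H+a_2)P,\qquad a_1,a_2\in\mathbb R.$$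
   Context: Coordinates are $x=(x^1,x^2,x^3,x^4)=(q_1,q_2,p_1,p_2)$. The canonical Poisson bivector $P$ has entries $P^{13}=P^{24}=1$, $P^{31}=P^{42}=-1$ and all others zero; $(P\,dH)^i=\sum_jP^{ij}\partial_jH$. Bivectors are given by their skew-symmetric matrices of entries $B^{ij}=-B^{ji}$. $\mathcal L_X$ is the Lie derivative: $(\mathcal L_XB)^{ij}=\sum_k\left(X^k\partial_kB^{ij}-B^{kj}\partial_kX^i-B^{ik}\partial_kX^j\right)$. "The solution is the family" means that the set of all solutions in the stated space is exactly that family. *)

theory Defs
  imports "HOL-Analysis.Analysis"
begin

primrec C_diff :: "nat \<Rightarrow> ('a::euclidean_space \<Rightarrow> real) \<Rightarrow> bool" where
  "C_diff 0 f \<longleftrightarrow> continuous_on UNIV f"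
| "C_diff (Suc k) f \<longleftrightarrow>
     f differentiable_on UNIV \<and> (\<forall>b\<in>Basis. C_diff k (\<lambda>x. frechet_derivative f (at x) b))"

definition smooth :: "('a::euclidean_space \<Rightarrow> real) \<Rightarrow> bool" where
  "smooth f \<longleftrightarrow> (\<forall>k. C_diff k f)"

definition partial_deriv :: "'n::finite \<Rightarrow> (real^'n \<Rightarrow> real) \<Rightarrow> real^'n \<Rightarrow> real" where
  "partial_deriv k f x = frechet_derivative f (at x) (axis k 1)"

text \<open>Bivectors are represented by their skew-symmetric matrices, the entry in row \<open>i\<close> and
  column \<open>j\<close> being \<open>B x $ i $ j\<close>.\<close>

definition bivector_field :: "(real^'n \<Rightarrow> real^'n^'n) \<Rightarrow> bool" where
  "bivector_field B \<longleftrightarrow> (\<forall>x i j. B x $ i $ j = - (B x $ j $ i))"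

definition lie_bivector ::
  "(real^'n \<Rightarrow> real^'n) \<Rightarrow> (real^'n \<Rightarrow> real^'n^'n) \<Rightarrow> real^'n \<Rightarrow> real^'n^'n" where
  "lie_bivector X B x = (\<chi> i j. \<Sum>k\<in>UNIV.
      X x $ k * partial_deriv k (\<lambda>y. B y $ i $ j) x
      - B x $ k $ j * partial_deriv k (\<lambda>y. X y $ i) x
      - B x $ i $ k * partial_deriv k (\<lambda>y. X y $ j) x)"

definition hamiltonian_field ::
  "real^'n^'n \<Rightarrow> (real^'n \<Rightarrow> real) \<Rightarrow> real^'n \<Rightarrow> real^'n" where
  "hamiltonian_field P H x = (\<chi> i. \<Sum>j\<in>UNIV. P $ i $ j * partial_deriv j H x)"

definition bivector4 :: "real \<Rightarrow> real \<Rightarrow> real \<Rightarrow> real \<Rightarrow> real \<Rightarrow> real \<Rightarrow> real^4^4" where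
  "bivector4 b12 b13 b14 b23 b24 b34 = vector
     [vector [0, b12, b13, b14],
      vector [- b12, 0, b23, b24],
      vector [- b13, - b23, 0, b34],
      vector [- b14, - b24, - b34, 0]]"

definition canonical_P :: "real^4^4" where
  "canonical_P = bivector4 0 1 0 0 1 0"

text \<open>A point \<open>x\<close> of phase space has coordinates
  \<open>q\<^sub>1 = x $ 1\<close>, \<open>q\<^sub>2 = x $ 2\<close>, \<open>p\<^sub>1 = x $ 3\<close>, \<open>p\<^sub>2 = x $ 4\<close>.\<close>

definition E1 :: "real^4 \<Rightarrow> real" where
  "E1 x = exp (x $ 1 / sqrt 3)"

definition E2 :: "real^4 \<Rightarrow> real" where
  "E2 x = exp (- (sqrt 3 / 2) * x $ 1 + x $ 2 / 2)"

definition toda_H :: "real \<Rightarrow> real^4 \<Rightarrow> real" where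
  "toda_H \<alpha> x = ((x $ 3)\<^sup>2 + (x $ 4)\<^sup>2) / 2 + E1 x + E2 x + \<alpha> * exp (- (x $ 2))"

definition toda_X :: "real \<Rightarrow> real^4 \<Rightarrow> real^4" where
  "toda_X \<alpha> = hamiltonian_field canonical_P (toda_H \<alpha>)"

definition P_tilde :: "real^4 \<Rightarrow> real^4^4" where
  "P_tilde x = bivector4
     (sqrt 3 * x $ 4 - 5 * x $ 3)
     ((x $ 4)\<^sup>2 / 2 + 5 * E2 x / 2)
     (- (x $ 3 * x $ 4) / 2 - sqrt 3 * E2 x / 2)
     (- (x $ 3 * x $ 4) / 2 - 5 * sqrt 3 * E1 x / 3 + 5 * sqrt 3 * E2 x / 2)
     ((x $ 3)\<^sup>2 / 2 - 3 * E2 x / 2 + E1 x)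
     (- (E2 x / 4) * x $ 3 + sqrt 3 * (2 * E1 x - 3 * E2 x) / 12 * x $ 4)"

definition quadratic_in_p :: "(real^4 \<Rightarrow> real) \<Rightarrow> bool" where
  "quadratic_in_p f \<longleftrightarrow> (\<exists>c :: nat \<Rightarrow> nat \<Rightarrow> real \<times> real \<Rightarrow> real.
     (\<forall>m n. smooth (c m n)) \<and>
     (\<forall>x. f x = (\<Sum>m\<le>2. \<Sum>n\<le>2 - m. c m n (x $ 1, x $ 2) * (x $ 3) ^ m * (x $ 4) ^ n)))"

definition quadratic_bivector_fields :: "(real^4 \<Rightarrow> real^4^4) set" where
  "quadratic_bivector_fields =
     {B. bivector_field B \<and> (\<forall>i j. quadratic_in_p (\<lambda>x. B x $ i $ j))}"

definition invariant_bivectors :: "real \<Rightarrow> (real^4 \<Rightarrow> real^4^4) set" where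
  "invariant_bivectors \<alpha> =
     {B \<in> quadratic_bivector_fields. \<forall>x. lie_bivector (toda_X \<alpha>) B x = 0}"

end

theory Submission
  imports Defs "HOL-Computational_Algebra.Polynomial"
begin

text \<open>
  In the linear coordinates \<open>u = q\<^sub>1 / sqrt 3\<close>, \<open>v = - sqrt 3 / 2 q\<^sub>1 + q\<^sub>2 / 2\<close> the potential is
  \<open>exp u + exp v + \<alpha> exp (- 3 u - 2 v)\<close>. Comparing coefficients of the velocities in the invariance
  equation, the parts of degree two are Killing tensors of the plane, hence quadratic polynomials in
  \<open>u, v\<close>. The parts of lower degree then have prescribed (symmetrised) gradients, and the
  integrability conditions (vanishing curl, Saint-Venant) are identities between products of
  polynomials and exponentials. By linear independence of these products the coefficient of each
  exponential vanishes separately, which leaves an explicit linear system for finitely many constants.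
  Since the invariant bivectors form a vector space containing the claimed family, it suffices that an
  invariant bivector on which three functionals (two if \<open>\<alpha> = 1\<close>) vanish is zero.
\<close>

section \<open>Smooth functions of two variables\<close>

text \<open>In the metric of the kinetic energy the exponents \<open>u\<close>, \<open>v\<close>
  have inner products 1/3, -1/2, 1: they are simple roots of type G2, and
  \<open>- 3 * u - 2 * v\<close> is minus the highest root. This is why all structure constants
  become rational in these coordinates. The obstacle is the coupling of all six entries. In the
  derivatives along the flow of the mixed entries \<open>c12\<close> and \<open>c21\<close>, the
  unknown velocity-velocity entry \<open>d\<close> occurs with opposite signs. It cancels in the
  sum, so \<open>c11\<close>, \<open>c22\<close> and \<open>c12 + c21\<close> all satisfy X c = K a,
  with \<open>a\<close> the position-position entry and K an explicit combination of the
  exponentials. The difference \<open>c12 - c21\<close> is X a itself. Integrability can thus be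
  exploited for several K and one \<open>a\<close>, and \<open>d\<close> is recovered by
  differentiating X a. The two lattices part at a single scalar identity: once the multiple of H P
  is split off, the leading coefficients of the surviving block are multiples of one constant \<mu>,
  and the periodic exponential demands \<open>9 * \<epsilon> * \<mu> = 0\<close>.\<close>

lemma C_diff_const: "C_diff k (\<lambda>x. c)"
proof (induction k arbitrary: c)
  case (Suc k)
  have "(\<lambda>x::'a. frechet_derivative (\<lambda>x::'a. c) (at x) b) = (\<lambda>x. 0)" for b
    by simp
  then show ?case using Suc by simp
qed simp

lemma C_diff_scale:
  assumes "C_diff k f"
  shows "C_diff k (\<lambda>x. c * f x)"
  using assms
proof (induction k arbitrary: f)
  case 0
  then show ?case by (auto intro!: continuous_intros)
next
  case (Suc k)
  have d: "f differentiable at x" for x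
    using Suc.prems by (simp add: differentiable_on_def)
  have "((\<lambda>x. c * f x) has_derivative (\<lambda>b. c * frechet_derivative f (at x) b)) (at x)" for x
    using d[of x, unfolded frechet_derivative_works] by (rule has_derivative_mult_right)
  then have "frechet_derivative (\<lambda>x. c * f x) (at x) = (\<lambda>b. c * frechet_derivative f (at x) b)"
    "(\<lambda>x. c * f x) differentiable at x" for x
    by (auto simp: frechet_derivative_at[symmetric] differentiable_def)
  then show ?case using Suc by (auto simp: differentiable_on_def)
qed

lemma C_diff_add:
  assumes "C_diff k f" "C_diff k g"
  shows "C_diff k (\<lambda>x. f x + g x)"
  using assms
proof (induction k arbitrary: f g)
  case 0
  then show ?case by (auto intro!: continuous_intros)
next
  case (Suc k)
  have d: "f differentiable at x" "g differentiable at x" for x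
    using Suc.prems by (simp_all add: differentiable_on_def)
  have "((\<lambda>x. f x + g x) has_derivative
      (\<lambda>b. frechet_derivative f (at x) b + frechet_derivative g (at x) b)) (at x)" for x
    using d[of x, unfolded frechet_derivative_works] by (rule has_derivative_add)
  then have "frechet_derivative (\<lambda>x. f x + g x) (at x) =
      (\<lambda>b. frechet_derivative f (at x) b + frechet_derivative g (at x) b)"
    "(\<lambda>x. f x + g x) differentiable at x" for x
    by (auto simp: frechet_derivative_at[symmetric] differentiable_def)
  then show ?case using Suc by (auto simp: differentiable_on_def)
qed

lemma C_diff_sum:
  assumes "finite S" "\<And>i. i \<in> S \<Longrightarrow> C_diff k (f i)"
  shows "C_diff k (\<lambda>x. \<Sum>i\<in>S. f i x)"
  using assms by (induction S rule: finite_induct) (auto simp: C_diff_const C_diff_add)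

text \<open>A directional derivative of the composite is a combination of partial derivatives of
  \<open>f\<close> composed with \<open>L\<close>. Its coefficients \<open>L b \<bullet> c\<close>
  are constants because \<open>L\<close> is linear, so the induction hypothesis applies to each
  summand.\<close>

lemma C_diff_compose_linear:
  fixes L :: "'a::euclidean_space \<Rightarrow> 'b::euclidean_space"
  assumes L: "linear L" and "C_diff k f"
  shows "C_diff k (\<lambda>x. f (L x))"
  using assms(2)
proof (induction k arbitrary: f)
  case 0
  have "continuous_on UNIV L"
    using L by (simp add: linear_continuous_on linear_conv_bounded_linear)
  then show ?case
    using 0 continuous_on_compose[of UNIV L f] by (auto simp: o_def intro: continuous_on_subset)
next
  case (Suc k)
  have d: "f differentiable at x" for x
    using Suc.prems by (simp add: differentiable_on_def)
  have lin: "linear (frechet_derivative f (at x))" for x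
    using d linear_frechet_derivative by blast
  have *: "((\<lambda>x. f (L x)) has_derivative (\<lambda>b. frechet_derivative f (at (L x)) (L b))) (at x)" for x
    using has_derivative_compose[OF linear_imp_has_derivative[OF L]
        d[of "L x", unfolded frechet_derivative_works]] .
  have "frechet_derivative f (at (L x)) (L b) =
      (\<Sum>c\<in>Basis. (L b \<bullet> c) * frechet_derivative f (at (L x)) c)" for x b
    by (subst (1) euclidean_representation[of "L b", symmetric])
      (simp add: linear_sum[OF lin] linear_cmul[OF lin])
  then have "(\<lambda>x. frechet_derivative (\<lambda>x. f (L x)) (at x) b) =
      (\<lambda>x. \<Sum>c\<in>Basis. (L b \<bullet> c) * frechet_derivative f (at (L x)) c)" for b
    using frechet_derivative_at[OF *] by (metis (no_types, lifting))
  moreover have "C_diff k (\<lambda>x. (L b \<bullet> c) * frechet_derivative f (at (L x)) c)"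
    if "c \<in> Basis" for b c
    using that Suc.prems Suc.IH[of "\<lambda>y. frechet_derivative f (at y) c"] by (auto intro: C_diff_scale)
  ultimately show ?case
    using differentiableI[OF *] by (auto simp: differentiable_on_def intro!: C_diff_sum)
qed

lemma C_diff_exp_linear:
  fixes l :: "'a::euclidean_space \<Rightarrow> real"
  assumes l: "linear l"
  shows "C_diff k (\<lambda>x. exp (l x))"
proof (induction k)
  case 0
  have "continuous_on UNIV l"
    using l by (simp add: linear_continuous_on linear_conv_bounded_linear)
  then show ?case by (auto intro!: continuous_intros)
next
  case (Suc k)
  have *: "((\<lambda>x. exp (l x)) has_derivative (\<lambda>b. l b * exp (l x))) (at x)" for x
    using DERIV_compose_FDERIV[OF DERIV_exp linear_imp_has_derivative[OF l]] .
  have "(\<lambda>x. frechet_derivative (\<lambda>x. exp (l x)) (at x) b) = (\<lambda>x. l b * exp (l x))" for b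
    using frechet_derivative_at[OF *] by metis
  then show ?case
    using * Suc by (auto simp: differentiable_on_def differentiable_def intro!: C_diff_scale)
qed

lemma smooth_const: "smooth (\<lambda>x. c)"
  and smooth_scale: "smooth f \<Longrightarrow> smooth (\<lambda>x. c * f x)"
  and smooth_add: "smooth f \<Longrightarrow> smooth g \<Longrightarrow> smooth (\<lambda>x. f x + g x)"
  and smooth_compose_linear: "linear L \<Longrightarrow> smooth h \<Longrightarrow> smooth (\<lambda>x. h (L x))"
  and smooth_exp_linear: "linear l \<Longrightarrow> smooth (\<lambda>x. exp (l x))"
  by (simp_all add: smooth_def C_diff_const C_diff_scale C_diff_add C_diff_compose_linear
      C_diff_exp_linear)

lemma smooth_minus: "smooth f \<Longrightarrow> smooth (\<lambda>x. - f x)"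
  using smooth_scale[of f "-1"] by simp

lemma smooth_diff: "smooth f \<Longrightarrow> smooth g \<Longrightarrow> smooth (\<lambda>x. f x - g x)"
  using smooth_add[of f "\<lambda>x. - g x"] smooth_minus[of g] by simp

lemmas smooth_intros = smooth_const smooth_scale smooth_add smooth_minus smooth_diff

lemma smooth_differentiable: "smooth f \<Longrightarrow> f differentiable at x"
  unfolding smooth_def by (drule spec[of _ "Suc 0"]) (simp add: differentiable_on_def)

lemma smooth_continuous: "smooth f \<Longrightarrow> continuous_on UNIV f"
  unfolding smooth_def by (drule spec[of _ 0]) simp

section \<open>Partial derivatives in the plane and their symmetry\<close>

definition du :: "(real \<times> real \<Rightarrow> real) \<Rightarrow> real \<times> real \<Rightarrow> real" where
  "du f z = frechet_derivative f (at z) (1, 0)"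

definition dv :: "(real \<times> real \<Rightarrow> real) \<Rightarrow> real \<times> real \<Rightarrow> real" where
  "dv f z = frechet_derivative f (at z) (0, 1)"

lemma smooth_du: "smooth f \<Longrightarrow> smooth (du f)" and smooth_dv: "smooth f \<Longrightarrow> smooth (dv f)"
proof -
  assume f: "smooth f"
  have b: "(1, 0) \<in> (Basis :: (real \<times> real) set)" "(0, 1) \<in> (Basis :: (real \<times> real) set)"
    by (auto simp: Basis_prod_def)
  have "C_diff k (du f)" "C_diff k (dv f)" for k
    using f[unfolded smooth_def, rule_format, of "Suc k"] b unfolding du_def[abs_def] dv_def[abs_def]
    by auto
  then show "smooth (du f)" "smooth (dv f)" by (auto simp: smooth_def)
qed

lemma smooth_has_derivative:
  assumes "smooth f"
  shows "(f has_derivative (\<lambda>h. fst h * du f z + snd h * dv f z)) (at z)"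
proof -
  have *: "(f has_derivative frechet_derivative f (at z)) (at z)"
    using smooth_differentiable[OF assms] by (simp add: frechet_derivative_works)
  then have lin: "linear (frechet_derivative f (at z))"
    using has_derivative_linear by blast
  have "frechet_derivative f (at z) h = fst h * du f z + snd h * dv f z" for h
  proof -
    have "h = fst h *\<^sub>R (1, 0) + snd h *\<^sub>R (0, 1)" by (cases h) simp
    then have "frechet_derivative f (at z) h
        = frechet_derivative f (at z) (fst h *\<^sub>R (1, 0) + snd h *\<^sub>R (0, 1))" by metis
    then show ?thesis
      by (simp only: linear_add[OF lin] linear_cmul[OF lin] du_def dv_def real_scaleR_def)
  qed
  then show ?thesis using * by presburger
qed

lemma smooth_DERIV_line:
  assumes "smooth f"
  shows "((\<lambda>t. f (u + t * a, v + t * b)) has_real_derivative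
    a * du f (u + t * a, v + t * b) + b * dv f (u + t * a, v + t * b)) (at t)"
proof -
  have "((\<lambda>t. (u + t * a, v + t * b)) has_derivative (\<lambda>h. (h * a, h * b))) (at t)"
    by (auto intro!: derivative_eq_intros)
  from has_derivative_compose[OF this smooth_has_derivative[OF assms]]
  show ?thesis unfolding has_field_derivative_def
    by (rule has_derivative_eq_rhs) (simp add: fun_eq_iff algebra_simps)
qed

lemma smooth_DERIV_fst:
  assumes "smooth f" shows "((\<lambda>t. f (t, v)) has_real_derivative du f (u, v)) (at u)"
  using smooth_DERIV_line[OF assms, of 0 1 v 0 u] by simp

lemma smooth_DERIV_snd:
  assumes "smooth f" shows "((\<lambda>t. f (u, t)) has_real_derivative dv f (u, v)) (at v)"
  using smooth_DERIV_line[OF assms, of u 0 0 1 v] by simp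

text \<open>Schwarz's theorem by second differences: the mean value theorem, applied twice in either
  order on a square of side \<open>h\<close> with corner \<open>z\<close>, yields two points of the
  square at which the two mixed derivatives agree. Continuity then forbids a gap at
  \<open>z\<close>.\<close>

lemma du_dv_commute:
  assumes f: "smooth f"
  shows "dv (du f) z = du (dv f) z"
proof (rule ccontr)
  \<comment> \<open>Half of the supposed gap: two errors strictly below \<open>e\<close> cannot
    bridge it.\<close>
  define e where "e = \<bar>dv (du f) z - du (dv f) z\<bar> / 2"
  assume "dv (du f) z \<noteq> du (dv f) z"
  then have "e > 0" by (simp add: e_def)
  obtain u v where z: "z = (u, v)" by (cases z)
  have cont: "isCont (dv (du f)) z" "isCont (du (dv f)) z"
    using smooth_continuous[OF smooth_dv[OF smooth_du[OF f]]]
      smooth_continuous[OF smooth_du[OF smooth_dv[OF f]]]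
    by (cases z, simp add: continuous_on_eq_continuous_at)+
  obtain d1 where d1: "d1 > 0" "\<And>y. dist y z < d1 \<Longrightarrow> dist (dv (du f) y) (dv (du f) z) < e"
    using cont(1)[unfolded continuous_at_eps_delta, rule_format, OF \<open>e > 0\<close>] by blast
  obtain d2 where d2: "d2 > 0" "\<And>y. dist y z < d2 \<Longrightarrow> dist (du (dv f) y) (du (dv f) z) < e"
    using cont(2)[unfolded continuous_at_eps_delta, rule_format, OF \<open>e > 0\<close>] by blast
  \<comment> \<open>Points inside the square are closer than \<open>2 * h\<close> to
    \<open>z\<close>, since the distance is at most the sum of the coordinate distances; hence half
    the smaller radius.\<close>
  define h where "h = min d1 d2 / 2"
  have h: "h > 0" "2 * h \<le> d1" "2 * h \<le> d2" using d1 d2 by (auto simp: h_def)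
  note D = smooth_DERIV_fst[OF f] smooth_DERIV_snd[OF f]
    smooth_DERIV_fst[OF smooth_dv[OF f]] smooth_DERIV_snd[OF smooth_du[OF f]]
  obtain x where x: "x > u" "x < u + h"
    "(f (u + h, v + h) - f (u + h, v)) - (f (u, v + h) - f (u, v))
      = (u + h - u) * (du f (x, v + h) - du f (x, v))"
    using MVT2[of u "u + h" "\<lambda>t. f (t, v + h) - f (t, v)" "\<lambda>t. du f (t, v + h) - du f (t, v)",
        OF _ DERIV_diff[OF D(1) D(1)]] h by auto
  obtain y where y: "y > v" "y < v + h"
    "du f (x, v + h) - du f (x, v) = (v + h - v) * dv (du f) (x, y)"
    using MVT2[of v "v + h" "\<lambda>t. du f (x, t)" "\<lambda>t. dv (du f) (x, t)", OF _ D(4)] h by auto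
  obtain y' where y': "y' > v" "y' < v + h"
    "(f (u + h, v + h) - f (u, v + h)) - (f (u + h, v) - f (u, v))
      = (v + h - v) * (dv f (u + h, y') - dv f (u, y'))"
    using MVT2[of v "v + h" "\<lambda>t. f (u + h, t) - f (u, t)" "\<lambda>t. dv f (u + h, t) - dv f (u, t)",
        OF _ DERIV_diff[OF D(2) D(2)]] h by auto
  obtain x' where x': "x' > u" "x' < u + h"
    "dv f (u + h, y') - dv f (u, y') = (u + h - u) * du (dv f) (x', y')"
    using MVT2[of u "u + h" "\<lambda>t. dv f (t, y')" "\<lambda>t. du (dv f) (t, y')", OF _ D(3)] h by auto
  have "h * (h * dv (du f) (x, y)) = h * (h * du (dv f) (x', y'))"
    using x(3)[unfolded y(3)] y'(3)[unfolded x'(3)] unfolding add_diff_cancel_left' by linarith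
  then have eq: "dv (du f) (x, y) = du (dv f) (x', y')" using h by simp
  have near: "dist (s, t) z < 2 * h" if "s > u" "s < u + h" "t > v" "t < v + h" for s t
  proof -
    have "dist (s, t) z \<le> dist s u + dist t v"
      unfolding z dist_Pair_Pair using sqrt_sum_squares_le_sum[of "dist s u" "dist t v"] by simp
    then show ?thesis using that by (simp add: dist_real_def)
  qed
  have "dist (dv (du f) (x, y)) (dv (du f) z) < e" "dist (du (dv f) (x', y')) (du (dv f) z) < e"
    using d1(2)[of "(x, y)"] d2(2)[of "(x', y')"] near[OF x(1,2) y(1,2)] near[OF x'(1,2) y'(1,2)] h
    by simp_all
  moreover have "\<bar>s - r\<bar> \<le> \<bar>w - s\<bar> + \<bar>w - r\<bar>" for r s w :: real by linarith
  ultimately show False using eq unfolding e_def dist_real_def by (metis add_strict_mono field_sum_of_halves not_less)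
qed

section \<open>Integrability of prescribed gradients and symmetrised gradients\<close>

lemma curl_free:
  assumes f: "smooth f"
    and "\<And>u v. du f (u, v) = F u v" "\<And>u v. dv f (u, v) = G u v"
    and "((\<lambda>t. F u t) has_real_derivative Fv) (at v)"
    and "((\<lambda>t. G t v) has_real_derivative Gu) (at u)"
  shows "Fv = Gu"
proof -
  have "((\<lambda>t. F u t) has_real_derivative dv (du f) (u, v)) (at v)"
    "((\<lambda>t. G t v) has_real_derivative du (dv f) (u, v)) (at u)"
    using smooth_DERIV_snd[OF smooth_du[OF f], of u v] smooth_DERIV_fst[OF smooth_dv[OF f], of v u]
      assms by simp_all
  then show ?thesis using du_dv_commute[OF f, of "(u, v)"] assms DERIV_unique by metis
qed

text \<open>The compatibility condition of plane elasticity, with \<open>f\<close>, \<open>g\<close>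
  as displacement and \<open>S1\<close>, \<open>S12\<close>, \<open>S2\<close> as strain. The data
  determine both partial derivatives of \<open>dv f\<close>, namely \<open>S1v\<close> and
  \<open>S12v - S2u\<close>, and the claim is \<open>curl_free\<close> for
  \<open>dv f\<close>.\<close>

lemma saint_venant:
  assumes f: "smooth f" and g: "smooth g"
    and S1: "\<And>u v. du f (u, v) = S1 u v" and S2: "\<And>u v. dv g (u, v) = S2 u v"
    and S12: "\<And>u v. dv f (u, v) + du g (u, v) = S12 u v"
    and D: "\<And>u v. ((\<lambda>t. S1 u t) has_real_derivative S1v u v) (at v)"
      "\<And>u v. ((\<lambda>t. S2 t v) has_real_derivative S2u u v) (at u)"
      "\<And>u v. ((\<lambda>t. S12 u t) has_real_derivative S12v u v) (at v)"
    and DD: "((\<lambda>t. S1v u t) has_real_derivative S1vv) (at v)"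
      "((\<lambda>t. S2u t v) has_real_derivative S2uu) (at u)"
      "((\<lambda>t. S12v t v) has_real_derivative S12vu) (at u)"
  shows "S1vv + S2uu = S12vu"
proof -
  have 1: "du (dv f) (u, v) = S1v u v" for u v
  proof -
    have "((\<lambda>t. S1 u t) has_real_derivative dv (du f) (u, v)) (at v)"
      using smooth_DERIV_snd[OF smooth_du[OF f], of u v] S1 by simp
    then show ?thesis using D(1) DERIV_unique du_dv_commute[OF f] by metis
  qed
  have 2: "dv (dv f) (u, v) = S12v u v - S2u u v" for u v
  proof -
    have "((\<lambda>t. S2 t v) has_real_derivative du (dv g) (u, v)) (at u)"
      using smooth_DERIV_fst[OF smooth_dv[OF g], of v u] S2 by simp
    then have g: "dv (du g) (u, v) = S2u u v" using D(2) DERIV_unique du_dv_commute[OF g] by metis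
    have "((\<lambda>t. dv f (u, t) + du g (u, t)) has_real_derivative dv (dv f) (u, v) + dv (du g) (u, v)) (at v)"
      by (intro DERIV_add smooth_DERIV_snd smooth_du smooth_dv f assms(2))
    then have "dv (dv f) (u, v) + dv (du g) (u, v) = S12v u v"
      using D(3) DERIV_unique unfolding S12 by blast
    then show ?thesis using g by simp
  qed
  have "S1vv = S12vu - S2uu"
    by (rule curl_free[OF smooth_dv[OF f] 1 2 DD(1)]) (intro DERIV_diff DD)
  then show ?thesis by simp
qed

lemma gradient_determines:
  assumes f: "smooth f"
    and "\<And>u v. du f (u, v) = F u v" "\<And>u v. dv f (u, v) = G u v"
    and "\<And>u v. ((\<lambda>t. h t v) has_real_derivative F u v) (at u)"
    and "\<And>u v. ((\<lambda>t. h u t) has_real_derivative G u v) (at v)"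
  shows "f (u, v) = h u v + (f (0, 0) - h 0 0)"
proof -
  have "((\<lambda>t. f (t, 0) - h t 0) has_real_derivative 0) (at t)"
    "((\<lambda>t. f (u, t) - h u t) has_real_derivative 0) (at t)" for t
    using DERIV_diff[OF smooth_DERIV_fst[OF f, of 0 t] assms(4)[where v=0 and u=t]]
      DERIV_diff[OF smooth_DERIV_snd[OF f, of u t] assms(5)[where v=t and u=u]] assms(2,3) by auto
  then have "f (u, 0) - h u 0 = f (0, 0) - h 0 0" "f (u, v) - h u v = f (u, 0) - h u 0"
    using DERIV_isconst_all by blast+
  then show ?thesis by simp
qed

lemma gradient_zero:
  assumes "smooth f" "\<And>z. du f z = 0" "\<And>z. dv f z = 0"
  shows "f z = f (0, 0)"
  using gradient_determines[OF assms(1), of "\<lambda>_ _. 0" "\<lambda>_ _. 0" "\<lambda>_ _. 0" "fst z" "snd z"] assms by simp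

lemma du_eq:
  assumes "smooth f" "\<And>u v. f (u, v) = F u v" "((\<lambda>t. F t v) has_real_derivative D) (at u)"
  shows "du f (u, v) = D"
  using smooth_DERIV_fst[OF assms(1), of v u] assms(2,3) DERIV_unique by simp

lemma dv_eq:
  assumes "smooth f" "\<And>u v. f (u, v) = F u v" "((\<lambda>t. F u t) has_real_derivative D) (at v)"
  shows "dv f (u, v) = D"
  using smooth_DERIV_snd[OF assms(1), of u v] assms(2,3) DERIV_unique by simp

lemma du_const: "du (\<lambda>z. k) z = 0" and dv_const: "dv (\<lambda>z. k) z = 0"
  by (simp_all add: du_def dv_def)

lemma
  assumes f: "smooth f" and g: "smooth g"
  shows du_add: "du (\<lambda>z. f z + g z) z = du f z + du g z"
    and dv_add: "dv (\<lambda>z. f z + g z) z = dv f z + dv g z"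
    and du_diff: "du (\<lambda>z. f z - g z) z = du f z - du g z"
    and dv_diff: "dv (\<lambda>z. f z - g z) z = dv f z - dv g z"
proof -
  obtain u v where z: "z = (u, v)" by (cases z)
  show "du (\<lambda>z. f z + g z) z = du f z + du g z" "du (\<lambda>z. f z - g z) z = du f z - du g z"
    unfolding z by (rule du_eq[OF _ refl]; intro smooth_intros f g DERIV_add DERIV_diff smooth_DERIV_fst)+
  show "dv (\<lambda>z. f z + g z) z = dv f z + dv g z" "dv (\<lambda>z. f z - g z) z = dv f z - dv g z"
    unfolding z by (rule dv_eq[OF _ refl]; intro smooth_intros f g DERIV_add DERIV_diff smooth_DERIV_snd)+
qed

lemma
  assumes f: "smooth f"
  shows du_scale: "du (\<lambda>z. k * f z) z = k * du f z"
    and dv_scale: "dv (\<lambda>z. k * f z) z = k * dv f z"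
proof -
  obtain u v where z: "z = (u, v)" by (cases z)
  show "du (\<lambda>z. k * f z) z = k * du f z"
    unfolding z by (rule du_eq[OF _ refl]; intro smooth_intros f DERIV_cmult smooth_DERIV_fst)
  show "dv (\<lambda>z. k * f z) z = k * dv f z"
    unfolding z by (rule dv_eq[OF _ refl]; intro smooth_intros f DERIV_cmult smooth_DERIV_snd)
qed

text \<open>The four equations say that \<open>(r \<partial>\<^sub>u + s \<partial>\<^sub>v) (A r\<^sup>2 + B r s + C s\<^sup>2) = 0\<close> identically in
  \<open>r\<close> and \<open>s\<close>.\<close>

lemma killing_tensor:
  assumes sm: "smooth A" "smooth B" "smooth C"
    and eqs: "\<And>z. du A z = 0" "\<And>z. dv A z + du B z = 0" "\<And>z. dv B z + du C z = 0" "\<And>z. dv C z = 0"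
  obtains \<alpha> \<beta> \<gamma> \<delta> \<kappa> \<zeta> where
    "\<And>u v. A (u, v) = \<alpha> + \<beta> * v + \<gamma> * v\<^sup>2"
    "\<And>u v. B (u, v) = \<delta> - \<beta> * u - \<kappa> * v - 2 * \<gamma> * u * v"
    "\<And>u v. C (u, v) = \<zeta> + \<kappa> * u + \<gamma> * u\<^sup>2"
proof -
  note s = smooth_du smooth_dv sm
  have A0: "du A = (\<lambda>z. 0)" and C0: "dv C = (\<lambda>z. 0)"
    and Bu: "du B = (\<lambda>z. (-1) * dv A z)" and Bv: "dv B = (\<lambda>z. (-1) * du C z)"
    using eqs by (auto simp: fun_eq_iff eq_neg_iff_add_eq_0 add.commute)
  have uvA: "du (dv A) = (\<lambda>z. 0)" and vuC: "dv (du C) = (\<lambda>z. 0)"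
    using du_dv_commute[OF sm(1)] du_dv_commute[OF sm(3)]
    by (simp_all add: A0 C0 fun_eq_iff du_const dv_const)
  \<comment> \<open>The mixed derivative of \<open>B\<close>, computed from \<open>Bu\<close> and
    from \<open>Bv\<close>. It equates a function of \<open>v\<close> alone with a function of
    \<open>u\<close> alone, so both are one constant, called \<open>2 * \<gamma>\<close>
    below.\<close>
  have 1: "dv (dv A) z = du (du C) z" for z
    using du_dv_commute[OF sm(2), of z] unfolding Bu Bv du_scale[OF smooth_du[OF sm(3)]]
      dv_scale[OF smooth_dv[OF sm(1)]] by simp
  have 2: "du (dv (dv A)) z = 0" for z
    using du_dv_commute[of "dv A" z] by (simp add: s uvA dv_const)
  have 3: "dv (dv (dv A)) z = 0" for z
  proof -
    have "dv (dv A) = du (du C)" using 1 by blast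
    then show ?thesis using du_dv_commute[of "du C" z] by (simp add: s vuC du_const)
  qed
  define \<gamma> where "\<gamma> = dv (dv A) (0, 0) / 2"
  have g: "dv (dv A) z = 2 * \<gamma>" "du (du C) z = 2 * \<gamma>" for z
    using gradient_zero[of "dv (dv A)" z] 1 2 3 by (auto simp: s \<gamma>_def)
  define \<beta> \<kappa> where "\<beta> = dv A (0, 0)" and "\<kappa> = du C (0, 0)"
  have Av: "dv A (u, v) = 2 * \<gamma> * v + \<beta>" for u v
    by (rule trans[OF gradient_determines[where F = "\<lambda>u v. 0" and G = "\<lambda>u v. 2 * \<gamma>" and h = "\<lambda>u v. 2 * \<gamma> * v"]])
      (auto simp: s uvA g \<beta>_def intro!: derivative_eq_intros)
  have Cu: "du C (u, v) = 2 * \<gamma> * u + \<kappa>" for u v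
    by (rule trans[OF gradient_determines[where F = "\<lambda>u v. 2 * \<gamma>" and G = "\<lambda>u v. 0" and h = "\<lambda>u v. 2 * \<gamma> * u"]])
      (auto simp: s vuC g \<kappa>_def intro!: derivative_eq_intros)
  have "A (u, v) = A (0, 0) + \<beta> * v + \<gamma> * v\<^sup>2" for u v
    by (rule trans[OF gradient_determines[where F = "\<lambda>u v. 0" and G = "\<lambda>u v. 2 * \<gamma> * v + \<beta>" and h = "\<lambda>u v. \<beta> * v + \<gamma> * v\<^sup>2"]])
      (auto simp: s A0 Av intro!: derivative_eq_intros)
  moreover have "C (u, v) = C (0, 0) + \<kappa> * u + \<gamma> * u\<^sup>2" for u v
    by (rule trans[OF gradient_determines[where F = "\<lambda>u v. 2 * \<gamma> * u + \<kappa>" and G = "\<lambda>u v. 0" and h = "\<lambda>u v. \<kappa> * u + \<gamma> * u\<^sup>2"]])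
      (auto simp: s C0 Cu intro!: derivative_eq_intros)
  moreover have "B (u, v) = B (0, 0) - \<beta> * u - \<kappa> * v - 2 * \<gamma> * u * v" for u v
    by (rule trans[OF gradient_determines[where F = "\<lambda>u v. - (2 * \<gamma> * v + \<beta>)" and G = "\<lambda>u v. - (2 * \<gamma> * u + \<kappa>)" and h = "\<lambda>u v. - \<beta> * u - \<kappa> * v - 2 * \<gamma> * u * v"]])
      (auto simp: s Bu Bv Av Cu intro!: derivative_eq_intros)
  ultimately show thesis using that by blast
qed

text \<open>The source \<open>k * exp v\<close> is what a constant coefficient \<open>a M11\<close>
  produces in the equation for \<open>c11\<close>. For \<open>k = 0\<close> the solutions are the
  linear first integrals of free motion: translations \<open>l\<close>, \<open>m\<close> and a
  rotation \<open>\<kappa>\<close>.\<close>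

lemma killing_vector:
  assumes sm: "smooth f" "smooth g"
    and eqs: "\<And>z. du f z = 0" "\<And>u v. dv f (u, v) + du g (u, v) = k * exp v" "\<And>z. dv g z = 0"
  obtains \<kappa> l m where
    "\<And>u v. f (u, v) = k * exp v + \<kappa> * v + l" "\<And>u v. g (u, v) = m - \<kappa> * u"
proof -
  note s = smooth_du smooth_dv sm
  have f0: "du f = (\<lambda>z. 0)" and g0: "dv g = (\<lambda>z. 0)" using eqs by auto
  have 1: "du (dv f) z = 0" "dv (du g) z = 0" for z
    using du_dv_commute[OF sm(1), of z] du_dv_commute[OF sm(2), of z]
    by (simp_all add: f0 g0 du_const dv_const)
  have 2: "dv (dv f) (u, v) = k * exp v" for u v
  proof -
    have "dv (\<lambda>z. dv f z + du g z) (u, v) = k * exp v"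
      by (rule dv_eq[where F = "\<lambda>u v. k * exp v"])
        (auto simp: eqs intro!: smooth_intros s derivative_eq_intros)
    then show ?thesis by (simp add: dv_add s 1)
  qed
  define \<kappa> where "\<kappa> = dv f (0, 0) - k"
  have 3: "dv f (u, v) = k * exp v + \<kappa>" for u v
    by (rule trans[OF gradient_determines[where F = "\<lambda>u v. 0" and G = "\<lambda>u v. k * exp v" and h = "\<lambda>u v. k * exp v"]])
      (auto simp: s 1 2 \<kappa>_def intro!: derivative_eq_intros)
  then have 4: "du g (u, v) = - \<kappa>" for u v using eqs(2)[of u v] by simp
  have "f (u, v) = k * exp v + \<kappa> * v + (f (0, 0) - k)" for u v
    by (rule trans[OF gradient_determines[where F = "\<lambda>u v. 0" and G = "\<lambda>u v. k * exp v + \<kappa>" and h = "\<lambda>u v. k * exp v + \<kappa> * v"]])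
      (auto simp: s eqs 3 intro!: derivative_eq_intros)
  moreover have "g (u, v) = g (0, 0) - \<kappa> * u" for u v
    by (rule trans[OF gradient_determines[where F = "\<lambda>u v. - \<kappa>" and G = "\<lambda>u v. 0" and h = "\<lambda>u v. - \<kappa> * u"]])
      (auto simp: s eqs 4 intro!: derivative_eq_intros)
  ultimately show thesis using that by blast
qed

text \<open>A Killing tensor appears here as a symmetrised gradient, the situation of
  \<open>a\<close> with X a = \<open>c12 - c21\<close>. Compatibility reads
  \<open>2 * \<gamma> + 2 * \<gamma> = - 2 * \<gamma>\<close> and removes \<open>\<gamma>\<close>;
  the constants \<open>l\<close>, \<open>\<mu>\<close>, \<open>\<nu>\<close> are the freedom of
  adding a Killing vector.\<close>

lemma killing_tensor_potential:
  assumes sm: "smooth f" "smooth g"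
    and eqs: "\<And>u v. du f (u, v) = \<alpha> + \<beta> * v + \<gamma> * v\<^sup>2"
      "\<And>u v. dv f (u, v) + du g (u, v) = \<delta> - \<beta> * u - \<kappa> * v - 2 * \<gamma> * u * v"
      "\<And>u v. dv g (u, v) = \<zeta> + \<kappa> * u + \<gamma> * u\<^sup>2"
  obtains l \<mu> \<nu> where
    "\<And>u v. f (u, v) = \<alpha> * u + \<beta> * u * v - \<kappa> * v\<^sup>2 + \<nu> * v + l"
    "\<And>u v. g (u, v) = \<zeta> * v + \<kappa> * u * v - \<beta> * u\<^sup>2 + (\<delta> - \<nu>) * u + \<mu>"
    "\<gamma> = 0"
proof -
  note s = smooth_du smooth_dv sm
  have "2 * \<gamma> + 2 * \<gamma> = - 2 * \<gamma>"
    by (rule saint_venant[OF sm eqs(1,3,2), where u = 0 and v = 0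
          and S1v = "\<lambda>u v. \<beta> + 2 * \<gamma> * v" and S2u = "\<lambda>u v. \<kappa> + 2 * \<gamma> * u" and S12v = "\<lambda>u v. - \<kappa> - 2 * \<gamma> * u"])
      (auto intro!: derivative_eq_intros)
  then have \<gamma>: "\<gamma> = 0" by simp
  have "dv (du f) (u, v) = \<beta>" for u v
    by (rule dv_eq[where F = "\<lambda>u v. \<alpha> + \<beta> * v"])
      (auto simp: s eqs \<gamma> intro!: derivative_eq_intros)
  moreover have "du (dv g) (u, v) = \<kappa>" for u v
    by (rule du_eq[where F = "\<lambda>u v. \<zeta> + \<kappa> * u"])
      (auto simp: s eqs \<gamma> intro!: derivative_eq_intros)
  ultimately have 1: "du (dv f) (u, v) = \<beta>" "du (dv g) (u, v) = \<kappa>" for u v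
    using du_dv_commute[OF sm(1), of "(u, v)"] by simp_all
  have 2: "dv (dv f) (u, v) = - 2 * \<kappa>" for u v
  proof -
    have "dv (\<lambda>z. dv f z + du g z) (u, v) = - \<kappa>"
      by (rule dv_eq[where F = "\<lambda>u v. \<delta> - \<beta> * u - \<kappa> * v"])
        (auto simp: eqs \<gamma> intro!: smooth_intros s derivative_eq_intros)
    then show ?thesis using 1(2)[of u v] by (simp add: dv_add s du_dv_commute)
  qed
  define \<nu> where "\<nu> = dv f (0, 0)"
  have 3: "dv f (u, v) = \<beta> * u - 2 * \<kappa> * v + \<nu>" for u v
    by (rule trans[OF gradient_determines[where F = "\<lambda>u v. \<beta>" and G = "\<lambda>u v. - 2 * \<kappa>" and h = "\<lambda>u v. \<beta> * u - 2 * \<kappa> * v"]])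
      (auto simp: s 1 2 \<nu>_def intro!: derivative_eq_intros)
  then have 4: "du g (u, v) = \<kappa> * v - 2 * \<beta> * u + (\<delta> - \<nu>)" for u v
    using eqs(2)[of u v] by (simp add: \<gamma>)
  have "f (u, v) = \<alpha> * u + \<beta> * u * v - \<kappa> * v\<^sup>2 + \<nu> * v + f (0, 0)" for u v
    by (rule trans[OF gradient_determines[where F = "\<lambda>u v. \<alpha> + \<beta> * v" and G = "\<lambda>u v. \<beta> * u - 2 * \<kappa> * v + \<nu>" and h = "\<lambda>u v. \<alpha> * u + \<beta> * u * v - \<kappa> * v\<^sup>2 + \<nu> * v"]])
      (auto simp: s eqs 3 \<gamma> intro!: derivative_eq_intros)
  moreover have "g (u, v) = \<zeta> * v + \<kappa> * u * v - \<beta> * u\<^sup>2 + (\<delta> - \<nu>) * u + g (0, 0)" for u v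
    by (rule trans[OF gradient_determines[where F = "\<lambda>u v. \<kappa> * v - 2 * \<beta> * u + (\<delta> - \<nu>)" and G = "\<lambda>u v. \<zeta> + \<kappa> * u" and h = "\<lambda>u v. \<zeta> * v + \<kappa> * u * v - \<beta> * u\<^sup>2 + (\<delta> - \<nu>) * u"]])
      (auto simp: s eqs 4 \<gamma> intro!: derivative_eq_intros)
  ultimately show thesis using that \<gamma> by blast
qed

section \<open>Linear independence of exponential polynomials\<close>

lemma exp_poly_tendsto_0:
  fixes p :: "real poly"
  assumes "c < 0"
  shows "((\<lambda>t. poly p t * exp (c * t)) \<longlongrightarrow> 0) at_top"
proof -
  have "((\<lambda>t. coeff p i * (t ^ i / exp (- c * t))) \<longlongrightarrow> 0) at_top" for i
  proof -
    have "filterlim (\<lambda>t. - c * t) at_top at_top"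
      using assms by (intro filterlim_tendsto_pos_mult_at_top[OF tendsto_const]) (auto simp: filterlim_ident)
    from filterlim_compose[OF tendsto_power_div_exp_0 this, of i]
    have "((\<lambda>t. coeff p i / (- c) ^ i * ((- c * t) ^ i / exp (- c * t))) \<longlongrightarrow> coeff p i / (- c) ^ i * 0) at_top"
      by (intro tendsto_mult tendsto_const)
    moreover have "coeff p i / (- c) ^ i * ((- c * t) ^ i / exp (- c * t))
        = coeff p i * (t ^ i / exp (- c * t))" for t
      using assms by (subst power_mult_distrib) simp
    ultimately show ?thesis by simp
  qed
  then have "((\<lambda>t. \<Sum>i\<le>degree p. coeff p i * (t ^ i / exp (- c * t))) \<longlongrightarrow> (\<Sum>i\<le>degree p. 0)) at_top"
    by (intro tendsto_sum)
  moreover have "(\<Sum>i\<le>degree p. coeff p i * (t ^ i / exp (- c * t))) = poly p t * exp (c * t)" for t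
    by (simp add: poly_altdef sum_distrib_left mult_ac exp_minus divide_inverse)
  ultimately show ?thesis by simp
qed

lemma poly_tendsto_0_imp_0:
  fixes p :: "real poly"
  assumes "((\<lambda>t. poly p t) \<longlongrightarrow> 0) at_top"
  shows "p = 0"
proof (rule ccontr)
  have pos: False if lim: "((\<lambda>t. poly q t) \<longlongrightarrow> 0) at_top" and lc: "lead_coeff q > 0" for q :: "real poly"
  proof -
    obtain n where "\<forall>x\<ge>n. poly q x \<ge> lead_coeff q"
      using poly_pinfty_gt_lc[OF lc] by blast
    then have "lead_coeff q \<le> 0"
      by (intro tendsto_lowerbound[OF lim]) (auto simp: eventually_at_top_linorder)
    then show False using lc by simp
  qed
  assume "p \<noteq> 0"
  then consider "lead_coeff p > 0" | "lead_coeff (- p) > 0"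
    by (metis lead_coeff_minus leading_coeff_0_iff linorder_neqE_linordered_idom neg_0_less_iff_less)
  then show False
    using pos[of p] pos[of "- p"] assms tendsto_minus[OF assms] by cases auto
qed

text \<open>Induction on the largest exponent \<open>b\<close>: after division by
  \<open>exp (b * t)\<close> every other term decays at infinity, so \<open>poly (p b)\<close> tends
  to zero and \<open>p b\<close> vanishes.\<close>

lemma exp_poly_independent:
  fixes p :: "real \<Rightarrow> real poly"
  assumes "finite S" "\<And>t. (\<Sum>r\<in>S. poly (p r) t * exp (r * t)) = 0" "r \<in> S"
  shows "p r = 0"
  using assms
proof (induction S arbitrary: r rule: finite_linorder_max_induct)
  case (insert b S)
  have eq: "poly (p b) t = - (\<Sum>r\<in>S. poly (p r) t * exp ((r - b) * t))" for t
  proof -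
    have "poly (p b) t * exp (b * t) + (\<Sum>r\<in>S. poly (p r) t * exp (r * t)) = 0"
      using insert.prems(1)[of t] insert.hyps by (subst (asm) sum.insert) auto
    then have "(poly (p b) t * exp (b * t) + (\<Sum>r\<in>S. poly (p r) t * exp (r * t))) * exp (- b * t) = 0"
      by simp
    moreover have "exp (r * t) * exp (- b * t) = exp ((r - b) * t)" for r
      by (simp add: algebra_simps flip: exp_add)
    ultimately show ?thesis
      by (simp add: distrib_right sum_distrib_right mult.assoc flip: exp_add)
  qed
  have "((\<lambda>t. - (\<Sum>r\<in>S. poly (p r) t * exp ((r - b) * t))) \<longlongrightarrow> - (\<Sum>r\<in>S. 0)) at_top"
    using insert.hyps by (intro tendsto_minus tendsto_sum exp_poly_tendsto_0) auto
  then have b: "p b = 0" by (intro poly_tendsto_0_imp_0) (simp add: eq)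
  have "(\<Sum>r\<in>S. poly (p r) t * exp (r * t)) = 0" for t
    using insert.prems(1)[of t] insert.hyps b by (subst (asm) sum.insert) auto
  with insert.IH b insert.prems(2) show ?case by blast
qed simp

text \<open>The one-variable result is used twice. For fixed \<open>v\<close> the sum, grouped by
  the first exponent, is an exponential polynomial in \<open>u\<close>; each of its coefficients is
  in turn an exponential polynomial in \<open>v\<close>.\<close>

lemma exp_poly2_independent:
  fixes p :: "real \<times> real \<Rightarrow> real poly poly"
  assumes S: "finite S" and r: "r \<in> S"
    and eq: "\<And>u v. (\<Sum>r\<in>S. poly (poly (p r) [:u:]) v * exp (fst r * u + snd r * v)) = 0"
  shows "p r = 0"
proof (rule poly_eqI)
  fix m
  define sl where "sl a = {b. (a, b) \<in> S}" for a
  have S': "S = Sigma (fst ` S) sl" by (force simp: sl_def)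
  have fin: "finite (fst ` S)" "\<And>a. finite (sl a)"
    using S by (auto simp: sl_def intro!: finite_subset[OF _ finite_imageI[OF S, of snd]] image_eqI[where f=snd])
  have pp: "poly (poly q [:u:]) v = poly (map_poly (\<lambda>c. poly c v) q) u" for q u v
    by (induction q) (simp_all add: map_poly_pCons)
  have "(\<Sum>a\<in>fst ` S. poly (\<Sum>b\<in>sl a. smult (exp (b * v)) (map_poly (\<lambda>c. poly c v) (p (a, b)))) u * exp (a * u)) = 0" for u v
  proof -
    have "(\<Sum>(a, b)\<in>Sigma (fst ` S) sl. poly (poly (p (a, b)) [:u:]) v * exp (a * u + b * v)) = 0"
      using eq[of u v] unfolding S'[symmetric] by (simp add: case_prod_unfold)
    then have "(\<Sum>a\<in>fst ` S. \<Sum>b\<in>sl a. poly (poly (p (a, b)) [:u:]) v * exp (a * u + b * v)) = 0"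
      using fin by (subst sum.Sigma) auto
    then show ?thesis
      by (simp add: pp poly_sum sum_distrib_left sum_distrib_right exp_add mult_ac)
  qed
  from exp_poly_independent[OF fin(1) this, of "fst r"]
  have "(\<Sum>b\<in>sl (fst r). smult (exp (b * v)) (map_poly (\<lambda>c. poly c v) (p (fst r, b)))) = 0" for v
    using r by blast
  then have "coeff (\<Sum>b\<in>sl (fst r). smult (exp (b * v)) (map_poly (\<lambda>c. poly c v) (p (fst r, b)))) m = 0" for v
    by simp
  then have "(\<Sum>b\<in>sl (fst r). poly (coeff (p (fst r, b)) m) v * exp (b * v)) = 0" for v
    by (simp add: coeff_sum coeff_map_poly mult.commute[of "poly _ _"])
  from exp_poly_independent[OF fin(2) this, of "snd r"]
  show "coeff (p r) m = coeff 0 m" using r by (simp add: sl_def)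
qed

text \<open>The form for concrete identities: an entry pairs the exponents of \<open>u\<close> and
  \<open>v\<close> with a coefficient. In \<open>[:[:c00, c01:], [:c10, c11:]:]\<close> the outer
  position counts powers of \<open>u\<close>, the inner one powers of \<open>v\<close>.\<close>

lemma exp_poly2_list_independent:
  fixes L :: "((real \<times> real) \<times> real poly poly) list"
  assumes "distinct (map fst L)"
    and eq: "\<And>u v. (\<Sum>(r, q)\<leftarrow>L. poly (poly q [:u:]) v * exp (fst r * u + snd r * v)) = 0"
  shows "list_all (\<lambda>(r, q). q = 0) L"
proof -
  define p where "p r = the (map_of L r)" for r
  have p: "p r = q" if "(r, q) \<in> set L" for r q
    using that assms(1) by (simp add: p_def)
  have "(\<Sum>r\<in>fst ` set L. poly (poly (p r) [:u:]) v * exp (fst r * u + snd r * v)) = 0" for u v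
  proof -
    have "(\<Sum>r\<in>fst ` set L. poly (poly (p r) [:u:]) v * exp (fst r * u + snd r * v))
        = (\<Sum>r\<leftarrow>map fst L. poly (poly (p r) [:u:]) v * exp (fst r * u + snd r * v))"
      using assms(1) by (subst sum_list_distinct_conv_sum_set) simp_all
    also have "\<dots> = (\<Sum>(r, q)\<leftarrow>L. poly (poly q [:u:]) v * exp (fst r * u + snd r * v))"
      using p by (auto simp: o_def intro!: arg_cong[where f=sum_list] map_cong)
    finally show ?thesis using eq by simp
  qed
  then have "p r = 0" if "r \<in> fst ` set L" for r
    using exp_poly2_independent[of "fst ` set L" r p] that by blast
  then show ?thesis using p by (force simp: list_all_iff)
qed

section \<open>The invariance equation by degree in the velocities\<close>

text \<open>The constructor \<open>Mmn\<close> stands for the monomial \<open>r\<^sup>m s\<^sup>n\<close> in the velocities.\<close>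

datatype monomial = M20 | M11 | M02 | M10 | M01 | M00

text \<open>The accelerations of \<open>u\<close> and \<open>v\<close> are \<open>- force1\<close>
  and \<open>- force2\<close>; the coefficients are inner products of the exponents. No
  \<open>\<epsilon>\<close> occurs in \<open>force1\<close> because \<open>- 3 * u - 2 * v\<close>
  is orthogonal to \<open>u\<close>.\<close>

definition force1 :: "real \<Rightarrow> real \<Rightarrow> real" where
  "force1 u v = exp u / 3 - exp v / 2"

definition force2 :: "real \<Rightarrow> real \<Rightarrow> real \<Rightarrow> real" where
  "force2 \<epsilon> u v = - exp u / 2 + exp v - \<epsilon> * exp (- 3 * u - 2 * v) / 2"

text \<open>The equation \<open>X (\<Sum>m. c m \<cdot> m) = (\<Sum>m. h m \<cdot> m)\<close> for the vector field
  \<open>X = r \<partial>\<^sub>u + s \<partial>\<^sub>v - force1 \<partial>\<^sub>r - force2 \<partial>\<^sub>s\<close>, one conjunct for each monomial in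
  \<open>r, s\<close> of degree at most three.\<close>

definition flow_eq ::
  "real \<Rightarrow> (monomial \<Rightarrow> real \<times> real \<Rightarrow> real) \<Rightarrow> (monomial \<Rightarrow> real \<Rightarrow> real \<Rightarrow> real) \<Rightarrow> bool" where
  "flow_eq \<epsilon> c h \<longleftrightarrow> (\<forall>u v.
     du (c M20) (u, v) = 0 \<and>
     dv (c M20) (u, v) + du (c M11) (u, v) = 0 \<and>
     dv (c M11) (u, v) + du (c M02) (u, v) = 0 \<and>
     dv (c M02) (u, v) = 0 \<and>
     du (c M10) (u, v) = h M20 u v \<and>
     dv (c M10) (u, v) + du (c M01) (u, v) = h M11 u v \<and>
     dv (c M01) (u, v) = h M02 u v \<and>
     du (c M00) (u, v) = h M10 u v + 2 * force1 u v * c M20 (u, v) + force2 \<epsilon> u v * c M11 (u, v) \<and>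
     dv (c M00) (u, v) = h M01 u v + force1 u v * c M11 (u, v) + 2 * force2 \<epsilon> u v * c M02 (u, v) \<and>
     force1 u v * c M10 (u, v) + force2 \<epsilon> u v * c M01 (u, v) + h M00 u v = 0)"

lemma flow_eqD:
  assumes "flow_eq \<epsilon> c h"
  shows "du (c M20) z = 0" "dv (c M20) z + du (c M11) z = 0"
    "dv (c M11) z + du (c M02) z = 0" "dv (c M02) z = 0"
    "du (c M10) (u, v) = h M20 u v" "dv (c M10) (u, v) + du (c M01) (u, v) = h M11 u v"
    "dv (c M01) (u, v) = h M02 u v"
    "du (c M00) (u, v) = h M10 u v + 2 * force1 u v * c M20 (u, v) + force2 \<epsilon> u v * c M11 (u, v)"
    "dv (c M00) (u, v) = h M01 u v + force1 u v * c M11 (u, v) + 2 * force2 \<epsilon> u v * c M02 (u, v)"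
    "force1 u v * c M10 (u, v) + force2 \<epsilon> u v * c M01 (u, v) + h M00 u v = 0"
proof -
  note * = assms[unfolded flow_eq_def, rule_format]
  show "du (c M20) z = 0" "dv (c M20) z + du (c M11) z = 0"
    "dv (c M11) z + du (c M02) z = 0" "dv (c M02) z = 0"
    using *[of "fst z" "snd z"] by simp_all
qed (use assms[unfolded flow_eq_def, rule_format, of u v] in simp_all)

section \<open>Consequences of X c = K a for a combination K of the three exponentials\<close>

text \<open>The equations at \<open>M10\<close> and \<open>M01\<close> prescribe the gradient of
  \<open>c M00\<close>, and the claims are coefficients of its curl condition. Plain constants
  belong to the leading part of \<open>c\<close>, the others to the linear part of \<open>a\<close>,
  in the shape given by \<open>killing_tensor_potential\<close> with \<open>\<rho>\<close> for
  \<open>\<delta>' - \<nu>\<close>. The last claim is the constant term at the periodic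
  exponential.\<close>

lemma flow_curl:
  assumes c: "smooth (c M00)"
    and flow: "flow_eq \<epsilon> c (\<lambda>m u v. (ku * exp u + kv * exp v + k0 * \<epsilon> * exp (- 3 * u - 2 * v)) * a m (u, v))"
    and K: "\<And>u v. c M20 (u, v) = \<alpha> + \<beta> * v + \<gamma> * v\<^sup>2"
      "\<And>u v. c M11 (u, v) = \<delta> - \<beta> * u - \<kappa> * v - 2 * \<gamma> * u * v"
      "\<And>u v. c M02 (u, v) = \<zeta> + \<kappa> * u + \<gamma> * u\<^sup>2"
    and a: "\<And>u v. a M10 (u, v) = \<alpha>' * u + \<beta>' * u * v - \<kappa>' * v\<^sup>2 + \<nu> * v + l"
      "\<And>u v. a M01 (u, v) = \<zeta>' * v + \<kappa>' * u * v - \<beta>' * u\<^sup>2 + \<rho> * u + \<mu>"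
  shows
    "ku * \<kappa>' = 2 * \<gamma> / 3" "ku * \<beta>' = - \<gamma>" "ku * (\<rho> - 3 * \<beta>') = \<beta> / 3 + \<kappa> + 3 * \<gamma>"
    "ku * (\<zeta>' + 3 * \<kappa>') = \<kappa> / 3 + 2 * \<gamma>" "ku * (\<mu> + \<rho> - \<nu>) = - \<delta> / 3 + \<zeta> + \<beta> + 3 * \<kappa> / 2"
    "kv * \<beta>' = 2 * \<gamma>" "kv * \<kappa>' = - \<gamma>" "kv * (\<alpha>' + 3 * \<beta>') = \<beta> + 6 * \<gamma>"
    "kv * (\<nu> - 3 * \<kappa>') = \<beta> + \<kappa> + 3 * \<gamma>" "kv * (l + \<nu> - \<rho>) = \<alpha> - \<delta> + 3 * \<beta> / 2 + 3 * \<kappa>"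
    "\<epsilon> * (k0 * (3 * \<mu> - 2 * l + \<nu> - \<rho>) + \<delta> - 3 * \<zeta> + 3 / 2 * \<kappa>) = 0"
proof -
  define f where "f u v = \<alpha>' * u + \<beta>' * u * v - \<kappa>' * v\<^sup>2 + \<nu> * v + l" for u v
  define g where "g u v = \<zeta>' * v + \<kappa>' * u * v - \<beta>' * u\<^sup>2 + \<rho> * u + \<mu>" for u v
  define F where "F u v = (ku * exp u + kv * exp v + k0 * \<epsilon> * exp (- 3 * u - 2 * v)) * f u v
    + 2 * force1 u v * (\<alpha> + \<beta> * v + \<gamma> * v\<^sup>2)
    + force2 \<epsilon> u v * (\<delta> - \<beta> * u - \<kappa> * v - 2 * \<gamma> * u * v)" for u v
  define G where "G u v = (ku * exp u + kv * exp v + k0 * \<epsilon> * exp (- 3 * u - 2 * v)) * g u v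
    + force1 u v * (\<delta> - \<beta> * u - \<kappa> * v - 2 * \<gamma> * u * v)
    + 2 * force2 \<epsilon> u v * (\<zeta> + \<kappa> * u + \<gamma> * u\<^sup>2)" for u v
  have FG: "du (c M00) (u, v) = F u v" "dv (c M00) (u, v) = G u v" for u v
    unfolding flow_eqD[OF flow] F_def G_def f_def g_def K a by simp_all
  have D1: "((\<lambda>t. F u t) has_real_derivative
      (kv * exp v - 2 * k0 * \<epsilon> * exp (- 3 * u - 2 * v)) * f u v
      + (ku * exp u + kv * exp v + k0 * \<epsilon> * exp (- 3 * u - 2 * v)) * (\<beta>' * u - 2 * \<kappa>' * v + \<nu>)
      - exp v * (\<alpha> + \<beta> * v + \<gamma> * v\<^sup>2) + 2 * force1 u v * (\<beta> + 2 * \<gamma> * v)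
      + (exp v + \<epsilon> * exp (- 3 * u - 2 * v)) * (\<delta> - \<beta> * u - \<kappa> * v - 2 * \<gamma> * u * v)
      + force2 \<epsilon> u v * (- \<kappa> - 2 * \<gamma> * u)) (at v)"
    (is "(_ has_real_derivative ?Fv u v) _") for u v
    unfolding F_def f_def force1_def force2_def
    by (auto intro!: derivative_eq_intros simp: field_simps)
  have D2: "((\<lambda>t. G t v) has_real_derivative
      (ku * exp u - 3 * k0 * \<epsilon> * exp (- 3 * u - 2 * v)) * g u v
      + (ku * exp u + kv * exp v + k0 * \<epsilon> * exp (- 3 * u - 2 * v)) * (\<kappa>' * v - 2 * \<beta>' * u + \<rho>)
      + exp u / 3 * (\<delta> - \<beta> * u - \<kappa> * v - 2 * \<gamma> * u * v) + force1 u v * (- \<beta> - 2 * \<gamma> * v)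
      + (- exp u + 3 * \<epsilon> * exp (- 3 * u - 2 * v)) * (\<zeta> + \<kappa> * u + \<gamma> * u\<^sup>2)
      + 2 * force2 \<epsilon> u v * (\<kappa> + 2 * \<gamma> * u)) (at u)"
    (is "(_ has_real_derivative ?Gu u v) _") for u v
    unfolding G_def g_def force1_def force2_def
    by (auto intro!: derivative_eq_intros simp: field_simps)
  note eq = curl_free[OF c FG D1 D2]
  have "list_all (\<lambda>(r, q). q = 0)
    [((1 :: real, 0 :: real), [:[:ku * (\<mu> + \<rho> - \<nu>) + \<delta> / 3 - \<zeta> - \<beta> - 3 * \<kappa> / 2, ku * (\<zeta>' + 3 * \<kappa>') - \<kappa> / 3 - 2 * \<gamma>:],
        [:ku * (\<rho> - 3 * \<beta>') - \<beta> / 3 - \<kappa> - 3 * \<gamma>, ku * \<kappa>' - 2 * \<gamma> / 3:], [:- ku * \<beta>' - \<gamma>:]:]),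
     ((0, 1), [:[:- kv * (l + \<nu> - \<rho>) + \<alpha> - \<delta> + 3 * \<beta> / 2 + 3 * \<kappa>, - kv * (\<nu> - 3 * \<kappa>') + \<beta> + \<kappa> + 3 * \<gamma>, kv * \<kappa>' + \<gamma>:],
        [:- kv * (\<alpha>' + 3 * \<beta>') + \<beta> + 6 * \<gamma>, - kv * \<beta>' + 2 * \<gamma>:]:]),
     ((-3, -2), [:[:- \<epsilon> * (k0 * (3 * \<mu> - 2 * l + \<nu> - \<rho>) + \<delta> - 3 * \<zeta> + 3 / 2 * \<kappa>),
         - \<epsilon> * (k0 * (3 * \<zeta>' - 2 * \<nu> - 3 * \<kappa>') - \<kappa>), - \<epsilon> * (2 * k0 * \<kappa>'):],
        [:- \<epsilon> * (k0 * (3 * \<rho> - 2 * \<alpha>' + 3 * \<beta>') - \<beta> + 3 * \<gamma> - 3 * \<kappa>),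
          - \<epsilon> * (k0 * (3 * \<kappa>' - 2 * \<beta>') - 2 * \<gamma>):], [:\<epsilon> * (3 * k0 * \<beta>' + 3 * \<gamma>):]:])]" (is "list_all _ ?L")
  proof (rule exp_poly2_list_independent)
    fix u v :: real
    define e0 where "e0 = exp (- 3 * u - 2 * v)"
    have e0: "exp (- (3 * u) - 2 * v) = e0" by (simp add: e0_def)
    have "(\<Sum>(r, q)\<leftarrow>?L. poly (poly q [:u:]) v * exp (fst r * u + snd r * v)) = ?Gu u v - ?Fv u v"
      unfolding force1_def force2_def f_def g_def
      by (simp add: e0 power2_eq_square) (simp add: field_simps)
    then show "(\<Sum>(r, q)\<leftarrow>?L. poly (poly q [:u:]) v * exp (fst r * u + snd r * v)) = 0"
      using eq by simp
  qed simp
  then show "ku * \<kappa>' = 2 * \<gamma> / 3" "ku * \<beta>' = - \<gamma>" "ku * (\<rho> - 3 * \<beta>') = \<beta> / 3 + \<kappa> + 3 * \<gamma>"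
    "ku * (\<zeta>' + 3 * \<kappa>') = \<kappa> / 3 + 2 * \<gamma>" "ku * (\<mu> + \<rho> - \<nu>) = - \<delta> / 3 + \<zeta> + \<beta> + 3 * \<kappa> / 2"
    "kv * \<beta>' = 2 * \<gamma>" "kv * \<kappa>' = - \<gamma>" "kv * (\<alpha>' + 3 * \<beta>') = \<beta> + 6 * \<gamma>"
    "kv * (\<nu> - 3 * \<kappa>') = \<beta> + \<kappa> + 3 * \<gamma>" "kv * (l + \<nu> - \<rho>) = \<alpha> - \<delta> + 3 * \<beta> / 2 + 3 * \<kappa>"
    "\<epsilon> * (k0 * (3 * \<mu> - 2 * l + \<nu> - \<rho>) + \<delta> - 3 * \<zeta> + 3 / 2 * \<kappa>) = 0"
    unfolding list.pred_inject split_conv pCons_eq_0_iff by linarith+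
qed

text \<open>\<open>c M10\<close> and \<open>c M01\<close> have the leading part of \<open>a\<close>,
  multiplied by K, as symmetrised gradient. The \<open>exp u\<close> part of K depends on
  \<open>u\<close> only, so in the compatibility condition it meets \<open>a M02\<close>
  undifferentiated; the resulting coefficients \<open>\<zeta> + 3 * \<kappa> + 6 * \<gamma>\<close>,
  \<open>\<kappa> + 6 * \<gamma>\<close>, \<open>\<gamma>\<close> are triangular. The
  \<open>exp v\<close> part treats \<open>a M20\<close> in the same way.\<close>

lemma flow_saint_venant:
  assumes c: "smooth (c M10)" "smooth (c M01)"
    and flow: "flow_eq \<epsilon> c (\<lambda>m u v. (ku * exp u + kv * exp v + k0 * \<epsilon> * exp (- 3 * u - 2 * v)) * a m (u, v))"
    and a: "\<And>u v. a M20 (u, v) = \<alpha> + \<beta> * v + \<gamma> * v\<^sup>2"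
      "\<And>u v. a M11 (u, v) = \<delta> - \<beta> * u - \<kappa> * v - 2 * \<gamma> * u * v"
      "\<And>u v. a M02 (u, v) = \<zeta> + \<kappa> * u + \<gamma> * u\<^sup>2"
  shows "ku * \<gamma> = 0" "ku * \<kappa> = 0" "ku * \<zeta> = 0" "kv * \<gamma> = 0" "kv * \<beta> = 0" "kv * \<alpha> = 0"
proof -
  define A where "A v = \<alpha> + \<beta> * v + \<gamma> * v\<^sup>2" for v
  define B where "B u v = \<delta> - \<beta> * u - \<kappa> * v - 2 * \<gamma> * u * v" for u v
  define C where "C u = \<zeta> + \<kappa> * u + \<gamma> * u\<^sup>2" for u
  define K where "K u v = ku * exp u + kv * exp v + k0 * \<epsilon> * exp (- 3 * u - 2 * v)" for u v
  define Ku where "Ku u v = ku * exp u - 3 * k0 * \<epsilon> * exp (- 3 * u - 2 * v)" for u v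
  define Kv where "Kv u v = kv * exp v - 2 * k0 * \<epsilon> * exp (- 3 * u - 2 * v)" for u v
  define Kuu where "Kuu u v = ku * exp u + 9 * k0 * \<epsilon> * exp (- 3 * u - 2 * v)" for u v
  define Kvv where "Kvv u v = kv * exp v + 4 * k0 * \<epsilon> * exp (- 3 * u - 2 * v)" for u v
  define Kuv where "Kuv u v = 6 * k0 * \<epsilon> * exp (- 3 * u - 2 * v)" for u v
  note K_defs = K_def Ku_def Kv_def Kuu_def Kvv_def Kuv_def
  have DK: "((\<lambda>t. K t v) has_real_derivative Ku u v) (at u)" "((\<lambda>t. K u t) has_real_derivative Kv u v) (at v)"
    "((\<lambda>t. Ku t v) has_real_derivative Kuu u v) (at u)" "((\<lambda>t. Kv u t) has_real_derivative Kvv u v) (at v)"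
    "((\<lambda>t. Kv t v) has_real_derivative Kuv u v) (at u)" for u v
    unfolding K_defs by (auto intro!: derivative_eq_intros simp: field_simps)
  have DA: "(A has_real_derivative \<beta> + 2 * \<gamma> * v) (at v)" "(C has_real_derivative \<kappa> + 2 * \<gamma> * v) (at v)" for v
    unfolding A_def C_def by (auto intro!: derivative_eq_intros)
  have DB: "((\<lambda>t. B t v) has_real_derivative - \<beta> - 2 * \<gamma> * v) (at u)"
    "((\<lambda>t. B u t) has_real_derivative - \<kappa> - 2 * \<gamma> * u) (at v)" for u v
    unfolding B_def by (auto intro!: derivative_eq_intros)
  have DL: "((\<lambda>t. p + q * t) has_real_derivative q) (at v)" for p q v :: real
    by (auto intro!: derivative_eq_intros)
  have S: "du (c M10) (u, v) = K u v * A v" "dv (c M01) (u, v) = K u v * C u"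
    "dv (c M10) (u, v) + du (c M01) (u, v) = K u v * B u v" for u v
    unfolding flow_eqD[OF flow] K_def A_def B_def C_def a by simp_all
  have "(Kvv u v * A v + (\<beta> + 2 * \<gamma> * v) * Kv u v + (2 * \<gamma> * K u v + Kv u v * (\<beta> + 2 * \<gamma> * v)))
      + (Kuu u v * C u + (\<kappa> + 2 * \<gamma> * u) * Ku u v + (2 * \<gamma> * K u v + Ku u v * (\<kappa> + 2 * \<gamma> * u)))
    = Kuv u v * B u v + (- \<beta> - 2 * \<gamma> * v) * Kv u v + (- 2 * \<gamma> * K u v + Ku u v * (- \<kappa> - 2 * \<gamma> * u))"
    (is "?lhs u v = ?rhs u v") for u v
  proof (rule saint_venant[OF c S, where S1v = "\<lambda>u v. Kv u v * A v + (\<beta> + 2 * \<gamma> * v) * K u v"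
          and S2u = "\<lambda>u v. Ku u v * C u + (\<kappa> + 2 * \<gamma> * u) * K u v"
          and S12v = "\<lambda>u v. Kv u v * B u v + (- \<kappa> - 2 * \<gamma> * u) * K u v"])
    show "((\<lambda>t. Kv t v * B t v + (- \<kappa> - 2 * \<gamma> * t) * K t v) has_real_derivative ?rhs u v) (at u)"
      using DL[of "- \<kappa>" "- 2 * \<gamma>" u] by (intro DERIV_add DERIV_mult DK DB) simp
  qed (intro DERIV_add DERIV_mult DK DA DB DL)+
  then have eq: "?lhs u v - ?rhs u v = 0" for u v by (simp only: right_minus_eq)
  have "list_all (\<lambda>(r, q). q = 0)
    [((1 :: real, 0 :: real), [:[:ku * (\<zeta> + 3 * \<kappa> + 6 * \<gamma>):], [:ku * (\<kappa> + 6 * \<gamma>):], [:ku * \<gamma>:]:]),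
     ((0, 1), [:[:kv * (\<alpha> + 3 * \<beta> + 6 * \<gamma>), kv * (\<beta> + 6 * \<gamma>), kv * \<gamma>:]:]),
     ((-3, -2), [:[:k0 * \<epsilon> * (4 * \<alpha> + 9 * \<zeta> - 6 * \<delta> - 6 * \<beta> - 9 * \<kappa> + 6 * \<gamma>),
         k0 * \<epsilon> * (4 * \<beta> + 6 * \<kappa> - 12 * \<gamma>), k0 * \<epsilon> * (4 * \<gamma>):],
       [:k0 * \<epsilon> * (9 * \<kappa> + 6 * \<beta> - 18 * \<gamma>), k0 * \<epsilon> * (12 * \<gamma>):], [:k0 * \<epsilon> * (9 * \<gamma>):]:])]" (is "list_all _ ?L")
  proof (rule exp_poly2_list_independent)
    fix u v :: real
    define e0 where "e0 = exp (- 3 * u - 2 * v)"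
    have e0: "exp (- (3 * u) - 2 * v) = e0" by (simp add: e0_def)
    have "(\<Sum>(r, q)\<leftarrow>?L. poly (poly q [:u:]) v * exp (fst r * u + snd r * v)) = ?lhs u v - ?rhs u v"
      unfolding K_defs A_def B_def C_def
      by (simp add: e0 power2_eq_square) (simp add: algebra_simps)
    then show "(\<Sum>(r, q)\<leftarrow>?L. poly (poly q [:u:]) v * exp (fst r * u + snd r * v)) = 0"
      by (simp only: eq)
  qed simp
  then show "ku * \<gamma> = 0" "ku * \<kappa> = 0" "ku * \<zeta> = 0" "kv * \<gamma> = 0" "kv * \<beta> = 0" "kv * \<alpha> = 0"
    unfolding list.pred_inject split_conv pCons_eq_0_iff distrib_left by linarith+
qed

text \<open>Without a leading part of \<open>a\<close> the linear part of \<open>c\<close> is a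
  Killing vector. The degree-zero equation
  \<open>force1 * c M10 + force2 * c M01 + K * x = 0\<close> excludes its rotation, and its
  \<open>exp u\<close> and \<open>exp v\<close> terms give the two relations.\<close>

lemma flow_eq_killing_vector:
  assumes sm: "smooth (c M10)" "smooth (c M01)"
    and flow: "flow_eq \<epsilon> c (\<lambda>m u v. (ku * exp u + kv * exp v + k0 * \<epsilon> * exp (- 3 * u - 2 * v)) * a m (u, v))"
    and a: "\<And>z. a M20 z = 0" "\<And>z. a M11 z = 0" "\<And>z. a M02 z = 0" "\<And>z. a M00 z = x"
  obtains p q where "\<And>z. c M10 z = p" "\<And>z. c M01 z = q"
    "p / 3 - q / 2 + ku * x = 0" "- p / 2 + q + kv * x = 0"
proof -
  obtain \<kappa> p q where
    f: "\<And>u v. c M10 (u, v) = 0 * exp v + \<kappa> * v + p" and g: "\<And>u v. c M01 (u, v) = q - \<kappa> * u"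
  proof (rule killing_vector[OF sm, of 0])
    show "du (c M10) z = 0" "dv (c M01) z = 0" for z
      by (cases z; simp add: flow_eqD[OF flow] a)+
    show "dv (c M10) (u, v) + du (c M01) (u, v) = 0 * exp v" for u v
      by (simp add: flow_eqD(6)[OF flow] a)
  qed blast
  have "list_all (\<lambda>(r, q). q = 0)
    [((1 :: real, 0 :: real), [:[:p / 3 - q / 2 + ku * x, \<kappa> / 3:], [:\<kappa> / 2:]:]),
     ((0, 1), [:[:- p / 2 + q + kv * x, - \<kappa> / 2:], [:- \<kappa>:]:]),
     ((-3, -2), [:[:\<epsilon> * (k0 * x - q / 2):], [:\<epsilon> * \<kappa> / 2:]:])]" (is "list_all _ ?L")
  proof (rule exp_poly2_list_independent)
    fix u v :: real
    show "(\<Sum>(r, q)\<leftarrow>?L. poly (poly q [:u:]) v * exp (fst r * u + snd r * v)) = 0"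
      using flow_eqD(10)[OF flow, where u = u and v = v] by (simp add: f g a force1_def force2_def) (simp add: field_simps)
  qed simp
  then have z: "\<kappa> = 0" "p / 3 - q / 2 + ku * x = 0" "- p / 2 + q + kv * x = 0" by auto
  then show thesis using f g by (intro that[of p q]) auto
qed

lemma flow_eq_add:
  assumes "\<And>m. smooth (c m)" "\<And>m. smooth (c' m)" "flow_eq \<epsilon> c h" "flow_eq \<epsilon> c' h'"
  shows "flow_eq \<epsilon> (\<lambda>m z. c m z + c' m z) (\<lambda>m u v. h m u v + h' m u v)"
  unfolding flow_eq_def du_add[OF assms(1,2)] dv_add[OF assms(1,2)] distrib_left
  using assms(3,4)[unfolded flow_eq_def, rule_format]
  by (intro allI conjI) (smt (verit))+

text \<open>The invariance equation in the coordinates \<open>(u, v, r, s)\<close>: \<open>a\<close> and \<open>d\<close> are the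
  position-position and velocity-velocity entries, \<open>c11, \<dots>, c22\<close> the mixed block.\<close>

locale toda_system =
  fixes \<epsilon> :: real and a c11 c12 c21 c22 d :: "monomial \<Rightarrow> real \<times> real \<Rightarrow> real"
  assumes sm: "smooth (a m)" "smooth (c11 m)" "smooth (c12 m)" "smooth (c21 m)" "smooth (c22 m)" "smooth (d m)"
    and a: "flow_eq \<epsilon> a (\<lambda>m u v. c12 m (u, v) - c21 m (u, v))"
    and c11: "flow_eq \<epsilon> c11 (\<lambda>m u v. exp v / 2 * a m (u, v))"
    and c12: "flow_eq \<epsilon> c12 (\<lambda>m u v. d m (u, v) - (exp v + \<epsilon> * exp (- 3 * u - 2 * v)) * a m (u, v))"
    and c21: "flow_eq \<epsilon> c21 (\<lambda>m u v. - d m (u, v) + exp u / 3 * a m (u, v))"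
    and c22: "flow_eq \<epsilon> c22 (\<lambda>m u v. - (exp u / 2 - 3 / 2 * \<epsilon> * exp (- 3 * u - 2 * v)) * a m (u, v))"
    and d: "flow_eq \<epsilon> d (\<lambda>m u v. - exp u * (c11 m (u, v) / 2 + c12 m (u, v) / 3)
      + exp v * (c21 m (u, v) + c22 m (u, v) / 2)
      + \<epsilon> * exp (- 3 * u - 2 * v) * (3 * c11 m (u, v) + 2 * c21 m (u, v)) / 2)"
begin

definition csum :: "monomial \<Rightarrow> real \<times> real \<Rightarrow> real" where
  "csum m z = c12 m z + c21 m z"

lemma sm_csum: "smooth (csum m)"
  unfolding csum_def[abs_def] by (intro smooth_add sm)

lemma flow_csum: "flow_eq \<epsilon> csum (\<lambda>m u v. (1 / 3 * exp u + (-1) * exp v + (-1) * \<epsilon> * exp (- 3 * u - 2 * v)) * a m (u, v))"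
  using flow_eq_add[OF sm(3,4) c12 c21] unfolding csum_def[abs_def] by (simp add: algebra_simps)

text \<open>The zero weights bring both equations to the common shape K a. That the
  \<open>exp u\<close> weight vanishes for \<open>c11\<close> and the \<open>exp v\<close> weight
  for \<open>c22\<close> drives the elimination.\<close>

lemma flow_c11: "flow_eq \<epsilon> c11 (\<lambda>m u v. (0 * exp u + 1 / 2 * exp v + 0 * \<epsilon> * exp (- 3 * u - 2 * v)) * a m (u, v))"
  and flow_c22: "flow_eq \<epsilon> c22 (\<lambda>m u v. (- 1 / 2 * exp u + 0 * exp v + 3 / 2 * \<epsilon> * exp (- 3 * u - 2 * v)) * a m (u, v))"
  using c11 c22 by (simp_all add: algebra_simps)


text \<open>\<open>X\<close> reverses parity in \<open>(r, s)\<close>, so the system decouples: the coefficients in which \<open>a, d\<close>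
  are odd and the mixed block is even are independent of the remaining ones.\<close>

lemma odd_part_constant:
  obtains l \<mu> A1 C1 A2 C2 As Bs Cs where
    "\<And>z. a M10 z = l" "\<And>z. a M01 z = \<mu>"
    "\<And>z. c11 M20 z = A1" "\<And>z. c11 M11 z = 3 * C1" "\<And>z. c11 M02 z = C1"
    "\<And>z. c22 M20 z = A2" "\<And>z. c22 M11 z = A2" "\<And>z. c22 M02 z = C2"
    "\<And>z. csum M20 z = As" "\<And>z. csum M11 z = Bs" "\<And>z. csum M02 z = Cs"
    "\<And>z. c12 M20 z = c21 M20 z" "\<And>z. c12 M11 z = c21 M11 z" "\<And>z. c12 M02 z = c21 M02 z"
    "l = 2 * (A1 - 3 * C1)" "A2 / 3 - C2 = \<mu> / 2" "\<mu> = 3 * Cs - Bs" "l = Bs - As"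
    "\<epsilon> * (3 / 2 * (3 * \<mu> - 2 * l) + A2 - 3 * C2) = 0"
proof -
  \<comment> \<open>By the equation for \<open>a\<close>, \<open>w\<close> is the derivative of
    \<open>a\<close> along the flow: its leading part is a Killing tensor and also the symmetrised
    gradient of \<open>a M10\<close>, \<open>a M01\<close>.\<close>
  define w where "w m z = c12 m z - c21 m z" for m z
  have smw: "smooth (w m)" for m unfolding w_def[abs_def] by (intro smooth_diff sm)
  have dw: "du (w m) z = du (c12 m) z - du (c21 m) z" "dv (w m) z = dv (c12 m) z - dv (c21 m) z" for m z
    unfolding w_def[abs_def] by (simp_all add: du_diff dv_diff sm)
  obtain \<alpha>' \<beta>' \<gamma>' \<delta>' \<kappa>' \<zeta>' where w:
    "\<And>u v. w M20 (u, v) = \<alpha>' + \<beta>' * v + \<gamma>' * v\<^sup>2"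
    "\<And>u v. w M11 (u, v) = \<delta>' - \<beta>' * u - \<kappa>' * v - 2 * \<gamma>' * u * v"
    "\<And>u v. w M02 (u, v) = \<zeta>' + \<kappa>' * u + \<gamma>' * u\<^sup>2"
  proof (rule killing_tensor[OF smw smw smw, of M20 M11 M02])
    fix z
    show "du (w M20) z = 0" "dv (w M20) z + du (w M11) z = 0"
      "dv (w M11) z + du (w M02) z = 0" "dv (w M02) z = 0"
      unfolding dw using flow_eqD(1-4)[OF c12, of z] flow_eqD(1-4)[OF c21, of z] by linarith+
  qed blast
  obtain l \<mu> \<nu> where a1:
    "\<And>u v. a M10 (u, v) = \<alpha>' * u + \<beta>' * u * v - \<kappa>' * v\<^sup>2 + \<nu> * v + l"
    "\<And>u v. a M01 (u, v) = \<zeta>' * v + \<kappa>' * u * v - \<beta>' * u\<^sup>2 + (\<delta>' - \<nu>) * u + \<mu>"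
    "\<gamma>' = 0"
    by (rule killing_tensor_potential[OF sm(1) sm(1)
          flow_eqD(5)[OF a, folded w_def, unfolded w] flow_eqD(6)[OF a, folded w_def, unfolded w]
          flow_eqD(7)[OF a, folded w_def, unfolded w]]) blast
  obtain \<alpha>1 \<beta>1 \<gamma>1 \<delta>1 \<kappa>1 \<zeta>1 where k11:
    "\<And>u v. c11 M20 (u, v) = \<alpha>1 + \<beta>1 * v + \<gamma>1 * v\<^sup>2"
    "\<And>u v. c11 M11 (u, v) = \<delta>1 - \<beta>1 * u - \<kappa>1 * v - 2 * \<gamma>1 * u * v"
    "\<And>u v. c11 M02 (u, v) = \<zeta>1 + \<kappa>1 * u + \<gamma>1 * u\<^sup>2"
    by (rule killing_tensor[OF sm(2) sm(2) sm(2) flow_eqD(1-4)[OF c11]]) blast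
  obtain \<alpha>2 \<beta>2 \<gamma>2 \<delta>2 \<kappa>2 \<zeta>2 where k22:
    "\<And>u v. c22 M20 (u, v) = \<alpha>2 + \<beta>2 * v + \<gamma>2 * v\<^sup>2"
    "\<And>u v. c22 M11 (u, v) = \<delta>2 - \<beta>2 * u - \<kappa>2 * v - 2 * \<gamma>2 * u * v"
    "\<And>u v. c22 M02 (u, v) = \<zeta>2 + \<kappa>2 * u + \<gamma>2 * u\<^sup>2"
    by (rule killing_tensor[OF sm(5) sm(5) sm(5) flow_eqD(1-4)[OF c22]]) blast
  obtain \<alpha>s \<beta>s \<gamma>s \<delta>s \<kappa>s \<zeta>s where ks:
    "\<And>u v. csum M20 (u, v) = \<alpha>s + \<beta>s * v + \<gamma>s * v\<^sup>2"
    "\<And>u v. csum M11 (u, v) = \<delta>s - \<beta>s * u - \<kappa>s * v - 2 * \<gamma>s * u * v"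
    "\<And>u v. csum M02 (u, v) = \<zeta>s + \<kappa>s * u + \<gamma>s * u\<^sup>2"
    by (rule killing_tensor[OF sm_csum sm_csum sm_csum flow_eqD(1-4)[OF flow_csum]]) blast
  note curl11 = flow_curl[OF sm(2) flow_c11 k11 a1(1,2)]
  note curl22 = flow_curl[OF sm(5) flow_c22 k22 a1(1,2)]
  note curls = flow_curl[OF sm_csum flow_csum ks a1(1,2)]
  \<comment> \<open>For \<open>c11\<close> the weight \<open>ku\<close> is 0, so the relations at
    \<open>exp u\<close> concern its own coefficients alone; those at \<open>exp v\<close>, where
    \<open>kv = 1 / 2\<close>, then bind \<open>a\<close>. For \<open>c22\<close> the two
    exponentials exchange roles.\<close>
  have z1: "\<gamma>1 = 0" "\<kappa>1 = 0" "\<beta>1 = 0" "\<delta>1 = 3 * \<zeta>1" using curl11 by linarith+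
  have z2: "\<gamma>2 = 0" "\<kappa>2 = 0" "\<beta>2 = 0" "\<delta>2 = \<alpha>2" using curl22 by linarith+
  have z': "\<beta>' = 0" "\<kappa>' = 0" "\<alpha>' = 0" "\<nu> = 0" using curl11 z1 by simp_all
  have z'': "\<delta>' = 0" "\<zeta>' = 0" using curl22 z2 z' by simp_all
  have zs: "\<gamma>s = 0" "\<kappa>s = 0" "\<beta>s = 0" using curls z' z'' by simp_all
  have "w m z = 0" if "m \<in> {M20, M11, M02}" for m z
    using that w z' z'' a1(3) by (cases z) auto
  then have w0: "c12 m z = c21 m z" if "m \<in> {M20, M11, M02}" for m z
    using that by (simp add: w_def)
  show thesis
  proof (rule that)
    show "a M10 z = l" "a M01 z = \<mu>" for z using a1 z' z'' by (cases z; simp)+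
    show "c11 M20 z = \<alpha>1" "c11 M11 z = 3 * \<zeta>1" "c11 M02 z = \<zeta>1" for z using k11 z1 by (cases z; simp)+
    show "c22 M20 z = \<alpha>2" "c22 M11 z = \<alpha>2" "c22 M02 z = \<zeta>2" for z using k22 z2 by (cases z; simp)+
    show "csum M20 z = \<alpha>s" "csum M11 z = \<delta>s" "csum M02 z = \<zeta>s" for z using ks zs by (cases z; simp)+
    show "c12 M20 z = c21 M20 z" "c12 M11 z = c21 M11 z" "c12 M02 z = c21 M02 z" for z
      by (simp_all add: w0)
    show "l = 2 * (\<alpha>1 - 3 * \<zeta>1)" using curl11(10) z1 z' z'' by simp
    show "\<alpha>2 / 3 - \<zeta>2 = \<mu> / 2" using curl22(5) z2 z' z'' by simp
    show "\<mu> = 3 * \<zeta>s - \<delta>s" using curls(5) zs z' z'' by simp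
    show "l = \<delta>s - \<alpha>s" using curls(10) zs z' z'' by simp
    show "\<epsilon> * (3 / 2 * (3 * \<mu> - 2 * l) + \<alpha>2 - 3 * \<zeta>2) = 0" using curl22(11) z2 z' z'' by simp
  qed
qed

text \<open>Eliminating \<open>d\<close> closes the system. Its linear part follows from the
  difference of the equations for \<open>c12\<close> and \<open>c21\<close>; its own degree-two
  equations, together with \<open>odd_part_constant\<close>, leave linear relations in which
  \<open>C1\<close> and \<open>\<mu>\<close> determine all leading coefficients.\<close>

lemma odd_part_zero:
  assumes k: "c11 M02 (0, 0) = 0" "a M01 (0, 0) = 0 \<or> \<epsilon> \<noteq> 0" "c11 M00 (0, 0) = 0"
  shows "a M10 z = 0" "a M01 z = 0" "d M10 z = 0" "d M01 z = 0"
    "\<And>m. m \<in> {M20, M11, M02, M00} \<Longrightarrow> c11 m z = 0 \<and> c12 m z = 0 \<and> c21 m z = 0 \<and> c22 m z = 0"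
proof -
  obtain l \<mu> A1 C1 A2 C2 As Bs Cs where
    a1: "\<And>z. a M10 z = l" "\<And>z. a M01 z = \<mu>"
    and k11: "\<And>z. c11 M20 z = A1" "\<And>z. c11 M11 z = 3 * C1" "\<And>z. c11 M02 z = C1"
    and k22: "\<And>z. c22 M20 z = A2" "\<And>z. c22 M11 z = A2" "\<And>z. c22 M02 z = C2"
    and ks: "\<And>z. csum M20 z = As" "\<And>z. csum M11 z = Bs" "\<And>z. csum M02 z = Cs"
    and w2: "\<And>z. c12 M20 z = c21 M20 z" "\<And>z. c12 M11 z = c21 M11 z" "\<And>z. c12 M02 z = c21 M02 z"
    and rel: "l = 2 * (A1 - 3 * C1)" "A2 / 3 - C2 = \<mu> / 2" "\<mu> = 3 * Cs - Bs" "l = Bs - As"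
      "\<epsilon> * (3 / 2 * (3 * \<mu> - 2 * l) + A2 - 3 * C2) = 0"
    by (rule odd_part_constant) blast
  have k12: "c12 M20 z = As / 2" "c12 M11 z = Bs / 2" "c12 M02 z = Cs / 2"
    "c21 M20 z = As / 2" "c21 M11 z = Bs / 2" "c21 M02 z = Cs / 2" for z
    using ks[of z] w2[of z] unfolding csum_def by simp_all
  define w0 where "w0 z = c12 M00 z - c21 M00 z" for z
  have smw: "smooth w0" unfolding w0_def[abs_def] by (intro smooth_diff sm)
  have w0: "w0 (u, v) = - l * force1 u v - \<mu> * force2 \<epsilon> u v" for u v
    using flow_eqD(10)[OF a, of u v] by (simp add: w0_def a1 algebra_simps)
  have duw: "du w0 (u, v) = - l * exp u / 3 - \<mu> * (- exp u / 2 + 3 / 2 * \<epsilon> * exp (- 3 * u - 2 * v))" for u v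
    by (rule du_eq[OF smw w0], unfold force1_def force2_def) (auto intro!: derivative_eq_intros simp: field_simps)
  have dvw: "dv w0 (u, v) = l * exp v / 2 - \<mu> * (exp v + \<epsilon> * exp (- 3 * u - 2 * v))" for u v
    by (rule dv_eq[OF smw w0], unfold force1_def force2_def) (auto intro!: derivative_eq_intros simp: field_simps)
  \<comment> \<open>Subtracting the equation for \<open>c21\<close> from that for \<open>c12\<close>
    cancels the force terms, because the leading parts agree, and leaves twice
    \<open>d M10\<close>.\<close>
  have d10: "d M10 (u, v) = l / 2 * (exp v + \<epsilon> * exp (- 3 * u - 2 * v)) + \<mu> / 4 * (exp u - 3 * \<epsilon> * exp (- 3 * u - 2 * v))" for u v
    using flow_eqD(8)[OF c12, of u v] flow_eqD(8)[OF c21, of u v] duw[of u v]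
    by (simp add: w0_def[abs_def] du_diff sm a1 k12 field_simps)
  have d01: "d M01 (u, v) = l / 4 * exp v + \<mu> / 6 * exp u" for u v
    using flow_eqD(9)[OF c12, of u v] flow_eqD(9)[OF c21, of u v] dvw[of u v]
    by (simp add: w0_def[abs_def] dv_diff sm a1 k12 field_simps)
  have "du (d M10) (u, v) = \<mu> / 4 * exp u + \<epsilon> * exp (- 3 * u - 2 * v) * (9 / 4 * \<mu> - 3 / 2 * l)" for u v
    by (rule du_eq[OF sm(6) d10]) (auto intro!: derivative_eq_intros simp: field_simps)
  \<comment> \<open>Two values of \<open>du (d M10)\<close>: the explicit formula differentiated,
    and the right-hand side of the equation for \<open>d\<close>.\<close>
  note e20 = this[unfolded flow_eqD(5)[OF d] k11 k12 k22]
  have "dv (d M01) (u, v) = l / 4 * exp v" for u v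
    by (rule dv_eq[OF sm(6) d01]) (auto intro!: derivative_eq_intros simp: field_simps)
  note e02 = this[unfolded flow_eqD(7)[OF d] k11 k12 k22]
  have "dv (d M10) (u, v) = l / 2 * exp v + \<epsilon> * exp (- 3 * u - 2 * v) * (3 / 2 * \<mu> - l)" for u v
    by (rule dv_eq[OF sm(6) d10]) (auto intro!: derivative_eq_intros simp: field_simps)
  moreover have "du (d M01) (u, v) = \<mu> / 6 * exp u" for u v
    by (rule du_eq[OF sm(6) d01]) (auto intro!: derivative_eq_intros simp: field_simps)
  ultimately have "dv (d M10) (u, v) + du (d M01) (u, v)
      = l / 2 * exp v + \<epsilon> * exp (- 3 * u - 2 * v) * (3 / 2 * \<mu> - l) + \<mu> / 6 * exp u" for u v
    by simp
  note e11 = this[unfolded flow_eqD(6)[OF d] k11 k12 k22]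
  have ind: "p = 0 \<and> q = 0" if "\<And>u v. p * exp u + q * exp v + r * exp (- 3 * u - 2 * v) = 0" for p q r :: real
  proof -
    have "list_all (\<lambda>(r, q). q = 0) [((1 :: real, 0 :: real), [:[:p:]:]), ((0, 1), [:[:q:]:]), ((-3, -2), [:[:r:]:])]"
      by (rule exp_poly2_list_independent) (use that in \<open>simp_all add: algebra_simps\<close>)
    then show ?thesis by simp
  qed
  have 20: "\<mu> / 4 + A1 / 2 + As / 6 = 0 \<and> - As / 2 - A2 / 2 = 0"
    apply (rule ind[where r = "\<epsilon> * (9 / 4 * \<mu> - 3 / 2 * l) - \<epsilon> * (3 * A1 + As) / 2"])
    subgoal for u v using e20[of u v] by (simp add: field_simps)
    done
  have 11: "\<mu> / 6 + 3 * C1 / 2 + Bs / 6 = 0 \<and> l / 2 - Bs / 2 - A2 / 2 = 0"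
    apply (rule ind[where r = "\<epsilon> * (3 / 2 * \<mu> - l) - \<epsilon> * (9 * C1 + Bs) / 2"])
    subgoal for u v using e11[of u v] by (simp add: field_simps)
    done
  have 02: "C1 / 2 + Cs / 6 = 0 \<and> l / 4 - Cs / 2 - C2 / 2 = 0"
    apply (rule ind[where r = "- \<epsilon> * (3 * C1 + Cs) / 2"])
    subgoal for u v using e02[of u v] by (simp add: field_simps)
    done
  have C1: "C1 = 0" using k(1) k11 by simp
  \<comment> \<open>For \<open>\<mu> = 1\<close> these are the leading coefficients of
    \<open>P_tilde\<close> minus H P, whose \<open>a\<close> is \<open>s - r\<close>.\<close>
  have 1: "l = - \<mu>" "A1 = - \<mu> / 2" "A2 = 0" "C2 = - \<mu> / 2" "As = 0" "Bs = - \<mu>" "Cs = 0"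
    using C1 rel(1-4) 20 11 02 by linarith+
  \<comment> \<open>With these values \<open>rel(5)\<close> becomes
    \<open>9 * \<epsilon> * \<mu> = 0\<close>.\<close>
  have \<mu>: "\<mu> = 0" using k(2) rel(5) by (auto simp: a1 1)
  note z = \<mu> C1 1[unfolded \<mu>]
  show "a M10 z = 0" "a M01 z = 0" by (simp_all add: a1 z)
  show "d M10 z = 0" "d M01 z = 0" by (cases z; simp add: d10 d01 z)+
  have "du (c M00) z = 0 \<and> dv (c M00) z = 0" if "c \<in> {c11, c12, c21, c22}" for c z
    using that by (cases z)
      (auto simp: flow_eqD(8,9)[OF c11] flow_eqD(8,9)[OF c12] flow_eqD(8,9)[OF c21] flow_eqD(8,9)[OF c22]
        k11 k12 k22 a1 d10 d01 z)
  then have const: "c M00 z = c M00 (0, 0)" if "c \<in> {c11, c12, c21, c22}" for c z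
    using that gradient_zero[of "c M00" z] sm by blast
  define x y w where "x = c12 M00 (0, 0)" "y = c21 M00 (0, 0)" "w = c22 M00 (0, 0)"
  have c0: "c11 M00 z = 0" "c12 M00 z = x" "c21 M00 z = y" "c22 M00 z = w" for z
    using const[of c11] const[of c12] const[of c21] const[of c22] k(3) by (auto simp: x_y_w_def)
  have "x = y" using w0[of 0 0] by (simp add: w0_def c0 z)
  \<comment> \<open>The degree-zero equation for \<open>d\<close> leaves only multiples of
    \<open>canonical_P\<close> among constant mixed blocks; here that multiple is zero since
    \<open>c11 M00\<close> vanishes.\<close>
  moreover have "x / 3 = 0 \<and> - y - w / 2 = 0"
  proof (rule ind[where r = "- \<epsilon> * y"])
    fix u v show "x / 3 * exp u + (- y - w / 2) * exp v + - \<epsilon> * y * exp (- 3 * u - 2 * v) = 0"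
      using flow_eqD(10)[OF d, of u v] by (simp add: c0 d10 d01 z field_simps)
  qed
  ultimately show "c11 m z = 0 \<and> c12 m z = 0 \<and> c21 m z = 0 \<and> c22 m z = 0"
    if "m \<in> {M20, M11, M02, M00}" for m
    using that by (auto simp: c0 k11 k12 k22 z)
qed

section \<open>The coefficients with \<open>a\<close>, \<open>d\<close> even and the mixed block
  odd\<close>

text \<open>The \<open>exp v\<close> weight of \<open>c11\<close> annihilates \<open>a M20\<close>
  and the \<open>exp u\<close> weight of \<open>c22\<close> annihilates \<open>a M02\<close>. Of the
  Killing tensor only the constant in \<open>a M11\<close> is then left.\<close>

lemma even_part_leading:
  obtains \<delta> where "\<And>z. a M20 z = 0" "\<And>z. a M11 z = \<delta>" "\<And>z. a M02 z = 0"
proof -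
  obtain \<alpha> \<beta> \<gamma> \<delta> \<kappa> \<zeta> where a2:
    "\<And>u v. a M20 (u, v) = \<alpha> + \<beta> * v + \<gamma> * v\<^sup>2"
    "\<And>u v. a M11 (u, v) = \<delta> - \<beta> * u - \<kappa> * v - 2 * \<gamma> * u * v"
    "\<And>u v. a M02 (u, v) = \<zeta> + \<kappa> * u + \<gamma> * u\<^sup>2"
    by (rule killing_tensor[OF sm(1) sm(1) sm(1) flow_eqD(1-4)[OF a]]) blast
  have "\<alpha> = 0" "\<beta> = 0" "\<gamma> = 0" "\<kappa> = 0" "\<zeta> = 0"
    using flow_saint_venant[OF sm(2) sm(2) flow_c11 a2] flow_saint_venant[OF sm(5) sm(5) flow_c22 a2]
    by simp_all
  then show thesis using a2 by (intro that[of \<delta>]) auto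
qed

text \<open>The degree-zero equation for \<open>c11\<close> can be solved for \<open>a M00\<close>;
  division by \<open>exp v\<close> creates the exponents \<open>u - v\<close> and
  \<open>- 3 * u - 3 * v\<close>. On the other hand \<open>du (w M10) = 2 * d M20\<close> is a
  polynomial, since the leading part of \<open>d\<close> is a Killing tensor too. Hence no
  exponential survives, which forces \<open>\<delta>\<close> and \<open>\<kappa>\<close> to
  vanish.\<close>

lemma even_part_constant:
  obtains l where "\<And>z. a M20 z = 0" "\<And>z. a M11 z = 0" "\<And>z. a M02 z = 0"
    "\<And>z. d M20 z = 0" "\<And>z. d M11 z = 0" "\<And>z. d M02 z = 0"
    "\<And>z. a M00 z = - l" "\<And>z. c11 M10 z = 3 * l" "\<And>z. c11 M01 z = 2 * l"
    "\<And>z. c12 M10 z = c21 M10 z" "\<And>z. c12 M01 z = c21 M01 z"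
proof -
  obtain \<delta> where a2: "\<And>z. a M20 z = 0" "\<And>z. a M11 z = \<delta>" "\<And>z. a M02 z = 0"
    by (rule even_part_leading) blast
  obtain \<kappa> l m where
    f: "\<And>u v. c11 M10 (u, v) = \<delta> / 2 * exp v + \<kappa> * v + l" and g: "\<And>u v. c11 M01 (u, v) = m - \<kappa> * u"
  proof (rule killing_vector[OF sm(2) sm(2), of M10 M01 "\<delta> / 2"])
    show "du (c11 M10) z = 0" "dv (c11 M01) z = 0" for z
      by (cases z; simp add: flow_eqD[OF c11] a2)+
    show "dv (c11 M10) (u, v) + du (c11 M01) (u, v) = \<delta> / 2 * exp v" for u v
      by (simp add: flow_eqD(6)[OF c11] a2)
  qed blast
  define w where "w m z = c12 m z - c21 m z" for m z
  have smw: "smooth (w m)" for m unfolding w_def[abs_def] by (intro smooth_diff sm)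
  have dw: "du (w m) z = du (c12 m) z - du (c21 m) z" "dv (w m) z = dv (c12 m) z - dv (c21 m) z" for m z
    unfolding w_def[abs_def] by (simp_all add: du_diff dv_diff sm)
  have a0u: "du (a M00) (u, v) = w M10 (u, v) + \<delta> * force2 \<epsilon> u v"
    and a0v: "dv (a M00) (u, v) = w M01 (u, v) + \<delta> * force1 u v" for u v
    by (simp_all add: flow_eqD(8,9)[OF a] a2 w_def)
  have wu: "du (w M10) (u, v) = 2 * d M20 (u, v)" and wv: "dv (w M01) (u, v) = 2 * d M02 (u, v)"
    and wuv: "dv (w M10) (u, v) + du (w M01) (u, v)
      = 2 * d M11 (u, v) - \<delta> * (exp v + \<epsilon> * exp (- 3 * u - 2 * v) + exp u / 3)" for u v
    unfolding dw using flow_eqD(5-7)[OF c12, of u v] flow_eqD(5-7)[OF c21, of u v]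
    by (simp_all add: a2 field_simps)
  have a0: "a M00 (u, v) = \<delta> / 2 * exp v + \<kappa> * v + l - 2 * m + 2 * \<kappa> * u - \<delta> / 3 * exp u
      - exp (u - v) * (2 / 3 * \<kappa> * v + 2 / 3 * l - m + \<kappa> * u) + \<epsilon> * exp (- 3 * u - 3 * v) * (m - \<kappa> * u)"
    (is "_ = ?rhs u v") for u v
  proof -
    have "exp v * a M00 (u, v) = - 2 * (force1 u v * (\<delta> / 2 * exp v + \<kappa> * v + l) + force2 \<epsilon> u v * (m - \<kappa> * u))"
      using flow_eqD(10)[OF c11, of u v] by (simp add: f g field_simps)
    moreover have "exp u = exp v * exp (u - v)" "exp (- 3 * u - 2 * v) = exp v * exp (- 3 * u - 3 * v)"
      by (simp_all flip: exp_add)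
    ultimately have "exp v * a M00 (u, v) = exp v * ?rhs u v"
      unfolding force1_def force2_def by (simp add: field_simps)
    then show ?thesis by simp
  qed
  have a0u': "du (a M00) (u, v) = 2 * \<kappa> - \<delta> / 3 * exp u
      - exp (u - v) * (2 / 3 * \<kappa> * v + 2 / 3 * l - m + \<kappa> * u + \<kappa>) + \<epsilon> * exp (- 3 * u - 3 * v) * (- 3 * m + 3 * \<kappa> * u - \<kappa>)" for u v
    by (rule du_eq[OF sm(1) a0]) (auto intro!: derivative_eq_intros simp: field_simps)
  obtain \<alpha>d \<beta>d \<gamma>d \<delta>d \<kappa>d \<zeta>d where d2:
    "\<And>u v. d M20 (u, v) = \<alpha>d + \<beta>d * v + \<gamma>d * v\<^sup>2"
    "\<And>u v. d M11 (u, v) = \<delta>d - \<beta>d * u - \<kappa>d * v - 2 * \<gamma>d * u * v"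
    "\<And>u v. d M02 (u, v) = \<zeta>d + \<kappa>d * u + \<gamma>d * u\<^sup>2"
    by (rule killing_tensor[OF sm(6) sm(6) sm(6) flow_eqD(1-4)[OF d]]) blast
  have w10: "w M10 (u, v) = 2 * \<kappa> - \<delta> / 3 * exp u
      - exp (u - v) * (2 / 3 * \<kappa> * v + 2 / 3 * l - m + \<kappa> * u + \<kappa>) + \<epsilon> * exp (- 3 * u - 3 * v) * (- 3 * m + 3 * \<kappa> * u - \<kappa>)
      - \<delta> * force2 \<epsilon> u v" for u v
    using a0u[of u v] a0u'[of u v] by simp
  have "du (w M10) (u, v) = \<delta> / 6 * exp u
      - exp (u - v) * (2 / 3 * \<kappa> * v + 2 / 3 * l - m + \<kappa> * u + 2 * \<kappa>) + \<epsilon> * exp (- 3 * u - 3 * v) * (9 * m - 9 * \<kappa> * u + 6 * \<kappa>)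
      - 3 / 2 * \<delta> * \<epsilon> * exp (- 3 * u - 2 * v)" for u v
    by (rule du_eq[OF smw w10], unfold force2_def) (auto intro!: derivative_eq_intros simp: field_simps)
  note uu = this[unfolded wu d2(1)]
  have "list_all (\<lambda>(r, q). q = 0)
    [((1 :: real, 0 :: real), [:[:\<delta> / 6:]:]),
     ((1, -1), [:[:- (2 / 3 * l - m + 2 * \<kappa>), - 2 / 3 * \<kappa>:], [:- \<kappa>:]:]),
     ((-3, -3), [:[:\<epsilon> * (9 * m + 6 * \<kappa>):], [:- 9 * \<epsilon> * \<kappa>:]:]),
     ((-3, -2), [:[:- 3 / 2 * \<delta> * \<epsilon>:]:]),
     ((0, 0), [:[:- 2 * \<alpha>d, - 2 * \<beta>d, - 2 * \<gamma>d:]:])]" (is "list_all _ ?L")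
  proof (rule exp_poly2_list_independent)
    fix u v :: real
    show "(\<Sum>(r, q)\<leftarrow>?L. poly (poly q [:u:]) v * exp (fst r * u + snd r * v)) = 0"
      using uu[of v u] by (simp add: power2_eq_square) (simp add: field_simps)
  qed simp
  then have z: "\<delta> = 0" "\<kappa> = 0" "m = 2 / 3 * l" "\<epsilon> * m = 0" by auto
  have a00: "a M00 (u, v) = - l / 3" for u v
    using a0[of u v] z by (cases "\<epsilon> = 0") simp_all
  have "du (a M00) (u, v) = 0" "dv (a M00) (u, v) = 0" for u v
    by (rule du_eq[OF sm(1) a00] dv_eq[OF sm(1) a00], simp)+
  then have w: "w M10 = (\<lambda>z. 0)" "w M01 = (\<lambda>z. 0)" using a0u a0v z by (auto simp: fun_eq_iff)
  show thesis
  \<comment> \<open>Since \<open>m = 2 / 3 * l\<close>, the factor 1/3 makes the three remaining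
    values integral multiples of one parameter.\<close>
  proof (rule that[of "l / 3"])
    show "a M20 z = 0" "a M11 z = 0" "a M02 z = 0" for z using a2 z by auto
    show "d M20 z = 0" "d M11 z = 0" "d M02 z = 0" for z
      using wu wv wuv by (cases z; simp add: w du_const dv_const \<open>\<delta> = 0\<close>)+
    show "a M00 z = - (l / 3)" "c11 M10 z = 3 * (l / 3)" "c11 M01 z = 2 * (l / 3)" for z
      by (cases z; simp add: a00 f g z)+
    show "c12 M10 z = c21 M10 z" "c12 M01 z = c21 M01 z" for z
      using fun_cong[OF w(1), of z] fun_cong[OF w(2), of z] by (simp_all add: w_def)
  qed
qed

text \<open>All is expressed by one constant \<open>l\<close>. The degree-zero equation for
  \<open>c12\<close> gives \<open>d M00\<close>, whose \<open>v\<close>-derivative contains no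
  \<open>exp u\<close>, whereas the equation for \<open>d\<close> puts
  \<open>- 2 / 3 * l * exp u\<close> there.\<close>

lemma even_part_zero:
  "m \<in> {M20, M11, M02, M00} \<Longrightarrow> a m z = 0 \<and> d m z = 0"
  "m \<in> {M10, M01} \<Longrightarrow> c11 m z = 0 \<and> c12 m z = 0 \<and> c21 m z = 0 \<and> c22 m z = 0"
proof -
  obtain l where a2: "\<And>z. a M20 z = 0" "\<And>z. a M11 z = 0" "\<And>z. a M02 z = 0"
    and d2: "\<And>z. d M20 z = 0" "\<And>z. d M11 z = 0" "\<And>z. d M02 z = 0"
    and a0: "\<And>z. a M00 z = - l" and k11: "\<And>z. c11 M10 z = 3 * l" "\<And>z. c11 M01 z = 2 * l"
    and w: "\<And>z. c12 M10 z = c21 M10 z" "\<And>z. c12 M01 z = c21 M01 z"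
    by (rule even_part_constant) blast
  obtain p q where k22: "\<And>z. c22 M10 z = p" "\<And>z. c22 M01 z = q"
    and r22: "p / 3 - q / 2 + - 1 / 2 * - l = 0" "- p / 2 + q + 0 * - l = 0"
    by (rule flow_eq_killing_vector[OF sm(5) sm(5) flow_c22 a2 a0]) blast
  obtain x y where ks: "\<And>z. csum M10 z = x" "\<And>z. csum M01 z = y"
    and rs: "x / 3 - y / 2 + 1 / 3 * - l = 0" "- x / 2 + y + -1 * - l = 0"
    by (rule flow_eq_killing_vector[OF sm_csum sm_csum flow_csum a2 a0]) blast
  have "x = - 2 * l" "y = - 2 * l" using rs by linarith+
  then have k12: "c12 M10 z = - l" "c12 M01 z = - l" "c21 M10 z = - l" "c21 M01 z = - l" for z
    using ks[of z] w[of z] unfolding csum_def by simp_all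
  have d0: "d M00 (u, v) = - l * (exp u / 6 + exp v / 2 + 3 / 2 * \<epsilon> * exp (- 3 * u - 2 * v))" for u v
    using flow_eqD(10)[OF c12, of u v] by (simp add: k12 a0 force1_def force2_def field_simps)
  have "dv (d M00) (u, v) = - l * (exp v / 2 - 3 * \<epsilon> * exp (- 3 * u - 2 * v))" for u v
    by (rule dv_eq[OF sm(6) d0]) (auto intro!: derivative_eq_intros simp: field_simps)
  note dvd = this[unfolded flow_eqD(9)[OF d] k11 k12 k22 d2]
  have "list_all (\<lambda>(r, q). q = 0)
    [((1 :: real, 0 :: real), [:[:- 2 / 3 * l:]:]), ((0, 1), [:[:- l / 2 + q / 2:]:]), ((-3, -2), [:[:- \<epsilon> * l:]:])]" (is "list_all _ ?L")
  proof (rule exp_poly2_list_independent)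
    fix u v :: real
    show "(\<Sum>(r, q)\<leftarrow>?L. poly (poly q [:u:]) v * exp (fst r * u + snd r * v)) = 0"
      using dvd[of u v] by simp (simp add: field_simps)
  qed simp
  then have l: "l = 0" by simp
  then have pq: "p = 0" "q = 0" using r22 by auto
  show "a m z = 0 \<and> d m z = 0" if "m \<in> {M20, M11, M02, M00}"
    using that by (cases z) (auto simp: a2 a0 d2 d0 l)
  show "c11 m z = 0 \<and> c12 m z = 0 \<and> c21 m z = 0 \<and> c22 m z = 0" if "m \<in> {M10, M01}"
    using that by (auto simp: k11 k12 k22 l pq)
qed

lemma all_zero:
  assumes "c11 M02 (0, 0) = 0" "a M01 (0, 0) = 0 \<or> \<epsilon> \<noteq> 0" "c11 M00 (0, 0) = 0"
  shows "a m z = 0" "c11 m z = 0" "c12 m z = 0" "c21 m z = 0" "c22 m z = 0" "d m z = 0"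
  using odd_part_zero[OF assms, where z = z] even_part_zero[where m = m and z = z] by (cases m; simp)+

end

section \<open>Invariant bivectors of the Toda lattices\<close>

lemma has_derivative_vec_nth: "((\<lambda>x. x $ i) has_derivative (\<lambda>h. h $ i)) F"
  by (rule bounded_linear_imp_has_derivative) (rule bounded_linear_vec_nth)

lemma frechet_derivative_sum_axis:
  fixes f :: "real^'n \<Rightarrow> real"
  assumes "f differentiable at x"
  shows "(\<Sum>k\<in>UNIV. X $ k * partial_deriv k f x) = frechet_derivative f (at x) X"
proof -
  have lin: "linear (frechet_derivative f (at x))"
    using assms linear_frechet_derivative by blast
  have "X = (\<Sum>k\<in>UNIV. X $ k *\<^sub>R axis k 1)"
    using basis_expansion[of X] by (simp add: scalar_mult_eq_scaleR)
  then have "frechet_derivative f (at x) X = frechet_derivative f (at x) (\<Sum>k\<in>UNIV. X $ k *\<^sub>R axis k 1)"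
    by simp
  then show ?thesis
    by (simp only: linear_sum[OF lin] linear_cmul[OF lin] partial_deriv_def real_scaleR_def)
qed

section \<open>The Toda field in canonical coordinates\<close>

text \<open>\<open>V1\<close> and \<open>V2\<close> form the gradient of the potential in the
  positions, and \<open>W11\<close>, \<open>W12\<close>, \<open>W22\<close> are its second
  derivatives. The periodic term depends on the second position alone, so only \<open>V2\<close> and
  \<open>W22\<close> carry \<open>\<alpha>\<close>.\<close>

definition V1 :: "real^4 \<Rightarrow> real" where
  "V1 x = E1 x / sqrt 3 - sqrt 3 / 2 * E2 x"

definition V2 :: "real \<Rightarrow> real^4 \<Rightarrow> real" where
  "V2 \<alpha> x = E2 x / 2 - \<alpha> * exp (- (x $ 2))"

lemma divide_sqrt_3: "a / sqrt 3 = a * sqrt 3 / 3"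
  by (simp add: field_simps)

lemma has_derivative_E1: "(E1 has_derivative (\<lambda>h. h $ 1 / sqrt 3 * E1 x)) (at x)"
  unfolding E1_def[abs_def] divide_sqrt_3
  by (auto intro!: derivative_eq_intros has_derivative_vec_nth simp: fun_eq_iff)

lemma has_derivative_E2: "(E2 has_derivative (\<lambda>h. (- (sqrt 3 / 2) * h $ 1 + h $ 2 / 2) * E2 x)) (at x)"
  unfolding E2_def[abs_def]
  by (auto intro!: derivative_eq_intros has_derivative_vec_nth simp: fun_eq_iff)

lemma has_derivative_toda_H:
  "(toda_H \<alpha> has_derivative (\<lambda>h. x $ 3 * h $ 3 + x $ 4 * h $ 4 + V1 x * h $ 1 + V2 \<alpha> x * h $ 2)) (at x)"
  unfolding toda_H_def[abs_def] V1_def V2_def divide_sqrt_3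
  by (auto intro!: derivative_eq_intros has_derivative_vec_nth has_derivative_E1 has_derivative_E2
      simp: fun_eq_iff field_simps divide_sqrt_3)

lemma vector_4 [simp]:
  "(vector [x, y, z, w] :: ('a::zero)^4) $ 1 = x"
  "(vector [x, y, z, w] :: ('a::zero)^4) $ 2 = y"
  "(vector [x, y, z, w] :: ('a::zero)^4) $ 3 = z"
  "(vector [x, y, z, w] :: ('a::zero)^4) $ 4 = w"
  unfolding vector_def by simp_all

lemma canonical_P_entries:
  "canonical_P $ 1 $ 1 = 0" "canonical_P $ 1 $ 2 = 0" "canonical_P $ 1 $ 3 = 1" "canonical_P $ 1 $ 4 = 0"
  "canonical_P $ 2 $ 1 = 0" "canonical_P $ 2 $ 2 = 0" "canonical_P $ 2 $ 3 = 0" "canonical_P $ 2 $ 4 = 1"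
  "canonical_P $ 3 $ 1 = -1" "canonical_P $ 3 $ 2 = 0" "canonical_P $ 3 $ 3 = 0" "canonical_P $ 3 $ 4 = 0"
  "canonical_P $ 4 $ 1 = 0" "canonical_P $ 4 $ 2 = -1" "canonical_P $ 4 $ 3 = 0" "canonical_P $ 4 $ 4 = 0"
  by (simp_all add: canonical_P_def bivector4_def)

lemma toda_X_nth:
  "toda_X \<alpha> x $ 1 = x $ 3" "toda_X \<alpha> x $ 2 = x $ 4" "toda_X \<alpha> x $ 3 = - V1 x" "toda_X \<alpha> x $ 4 = - V2 \<alpha> x"
proof -
  have "partial_deriv k (toda_H \<alpha>) x = x $ 3 * axis k 1 $ 3 + x $ 4 * axis k 1 $ 4
      + V1 x * axis k 1 $ 1 + V2 \<alpha> x * axis k 1 $ 2" for k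
    unfolding partial_deriv_def frechet_derivative_at[OF has_derivative_toda_H, symmetric] ..
  then show "toda_X \<alpha> x $ 1 = x $ 3" "toda_X \<alpha> x $ 2 = x $ 4" "toda_X \<alpha> x $ 3 = - V1 x" "toda_X \<alpha> x $ 4 = - V2 \<alpha> x"
    by (simp_all add: toda_X_def hamiltonian_field_def sum_4 canonical_P_entries axis_def)
qed

definition W11 :: "real^4 \<Rightarrow> real" where "W11 x = E1 x / 3 + 3 / 4 * E2 x"
definition W12 :: "real^4 \<Rightarrow> real" where "W12 x = - sqrt 3 / 4 * E2 x"
definition W22 :: "real \<Rightarrow> real^4 \<Rightarrow> real" where "W22 \<alpha> x = E2 x / 4 + \<alpha> * exp (- (x $ 2))"

lemma has_derivative_V1: "(V1 has_derivative (\<lambda>h. W11 x * h $ 1 + W12 x * h $ 2)) (at x)"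
  unfolding V1_def[abs_def] W11_def W12_def divide_sqrt_3
  by (auto intro!: derivative_eq_intros has_derivative_E1 has_derivative_E2 simp: fun_eq_iff field_simps divide_sqrt_3)

lemma has_derivative_V2: "(V2 \<alpha> has_derivative (\<lambda>h. W12 x * h $ 1 + W22 \<alpha> x * h $ 2)) (at x)"
  unfolding V2_def[abs_def] W12_def W22_def
  by (auto intro!: derivative_eq_intros has_derivative_vec_nth has_derivative_E2 simp: fun_eq_iff field_simps divide_sqrt_3)

lemma partial_deriv_toda_X:
  "partial_deriv k (\<lambda>y. toda_X \<alpha> y $ 1) x = axis k 1 $ 3"
  "partial_deriv k (\<lambda>y. toda_X \<alpha> y $ 2) x = axis k 1 $ 4"
  "partial_deriv k (\<lambda>y. toda_X \<alpha> y $ 3) x = - (W11 x * axis k 1 $ 1 + W12 x * axis k 1 $ 2)"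
  "partial_deriv k (\<lambda>y. toda_X \<alpha> y $ 4) x = - (W12 x * axis k 1 $ 1 + W22 \<alpha> x * axis k 1 $ 2)"
  unfolding partial_deriv_def toda_X_nth
    frechet_derivative_at[OF has_derivative_vec_nth, symmetric]
    frechet_derivative_at[OF has_derivative_minus[OF has_derivative_V1], symmetric]
    frechet_derivative_at[OF has_derivative_minus[OF has_derivative_V2], symmetric]
  by simp_all

definition XD :: "real \<Rightarrow> (real^4 \<Rightarrow> real) \<Rightarrow> real^4 \<Rightarrow> real" where
  "XD \<alpha> f x = frechet_derivative f (at x) (toda_X \<alpha> x)"

lemma XD_eqI: "(f has_derivative f') (at x) \<Longrightarrow> XD \<alpha> f x = f' (toda_X \<alpha> x)"
  unfolding XD_def by (drule frechet_derivative_at) simp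

lemma XD_add:
  assumes "f differentiable at x" "g differentiable at x"
  shows "XD \<alpha> (\<lambda>x. f x + g x) x = XD \<alpha> f x + XD \<alpha> g x"
  using XD_eqI[OF has_derivative_add[OF assms[unfolded frechet_derivative_works]]] by (simp add: XD_def)

lemma XD_scale:
  assumes "f differentiable at x"
  shows "XD \<alpha> (\<lambda>x. k * f x) x = k * XD \<alpha> f x"
  using XD_eqI[OF has_derivative_mult_right[OF assms[unfolded frechet_derivative_works]]] by (simp add: XD_def)

lemma XD_mult:
  assumes "f differentiable at x" "g differentiable at x"
  shows "XD \<alpha> (\<lambda>x. f x * g x) x = f x * XD \<alpha> g x + XD \<alpha> f x * g x"
  using XD_eqI[OF has_derivative_mult[OF assms[unfolded frechet_derivative_works]]] by (simp add: XD_def)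

lemma lie_bivector_toda_nth:
  assumes "\<And>i j. (\<lambda>y. B y $ i $ j) differentiable at x"
  shows "lie_bivector (toda_X \<alpha>) B x $ i $ j = XD \<alpha> (\<lambda>y. B y $ i $ j) x
    - (\<Sum>k\<in>UNIV. B x $ k $ j * partial_deriv k (\<lambda>y. toda_X \<alpha> y $ i) x)
    - (\<Sum>k\<in>UNIV. B x $ i $ k * partial_deriv k (\<lambda>y. toda_X \<alpha> y $ j) x)"
  by (simp add: lie_bivector_def sum_subtractf frechet_derivative_sum_axis[OF assms] XD_def)

text \<open>The Jacobian of the field consists of an identity block and minus the Hessian of the
  potential, so each algebraic term is an entry of \<open>B\<close>, possibly times a second
  derivative. By skew symmetry the six entries above the diagonal suffice.\<close>

lemma lie_bivector_toda_eq_0_iff: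
  assumes B: "bivector_field B" and diff: "\<And>i j. (\<lambda>y. B y $ i $ j) differentiable at x"
  shows "lie_bivector (toda_X \<alpha>) B x = 0 \<longleftrightarrow>
    XD \<alpha> (\<lambda>y. B y $ 1 $ 2) x = B x $ 1 $ 4 - B x $ 2 $ 3 \<and>
    XD \<alpha> (\<lambda>y. B y $ 1 $ 3) x = - B x $ 1 $ 2 * W12 x \<and>
    XD \<alpha> (\<lambda>y. B y $ 1 $ 4) x = B x $ 3 $ 4 - B x $ 1 $ 2 * W22 \<alpha> x \<and>
    XD \<alpha> (\<lambda>y. B y $ 2 $ 3) x = - B x $ 3 $ 4 + B x $ 1 $ 2 * W11 x \<and>
    XD \<alpha> (\<lambda>y. B y $ 2 $ 4) x = B x $ 1 $ 2 * W12 x \<and>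
    XD \<alpha> (\<lambda>y. B y $ 3 $ 4) x = B x $ 1 $ 3 * W12 x + B x $ 2 $ 3 * W22 \<alpha> x
      - B x $ 1 $ 4 * W11 x - B x $ 2 $ 4 * W12 x"
proof -
  have sk0: "B y $ i $ j = - B y $ j $ i" for y i j
    using B unfolding bivector_field_def by blast
  have sk1: "B y $ i $ i = 0" for y i using sk0[of y i i] by simp
  have sk: "B y $ 2 $ 1 = - B y $ 1 $ 2" "B y $ 3 $ 1 = - B y $ 1 $ 3"
    "B y $ 4 $ 1 = - B y $ 1 $ 4" "B y $ 3 $ 2 = - B y $ 2 $ 3" "B y $ 4 $ 2 = - B y $ 2 $ 4"
    "B y $ 4 $ 3 = - B y $ 3 $ 4" for y by (rule sk0)+
  have XD0: "XD \<alpha> (\<lambda>y. 0) x = 0" by (rule XD_eqI[OF has_derivative_const])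
  have XDm: "XD \<alpha> (\<lambda>y. - B y $ i $ j) x = - XD \<alpha> (\<lambda>y. B y $ i $ j) x" for i j
    using XD_scale[OF diff, where k = "-1"] by simp
  show ?thesis
    unfolding vec_eq_iff forall_4 lie_bivector_toda_nth[OF diff]
    by (simp add: partial_deriv_toda_X sum_4 axis_def sk sk1 XD0 XDm)
      (intro iffI conjI; elim conjE; simp add: algebra_simps; linarith)
qed

section \<open>Functions quadratic in the momenta\<close>

definition quad :: "(monomial \<Rightarrow> real \<times> real \<Rightarrow> real) \<Rightarrow> real \<times> real \<Rightarrow> real \<Rightarrow> real \<Rightarrow> real" where
  "quad c z r s = c M20 z * r\<^sup>2 + c M11 z * (r * s) + c M02 z * s\<^sup>2 + c M10 z * r + c M01 z * s + c M00 z"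

lemma quadratic_in_p_iff:
  "quadratic_in_p f \<longleftrightarrow>
    (\<exists>c. (\<forall>m. smooth (c m)) \<and> (\<forall>x. f x = quad c (x $ 1, x $ 2) (x $ 3) (x $ 4)))"
proof
  assume "quadratic_in_p f"
  then obtain c where sm: "\<And>m n. smooth (c m n)"
    and f: "\<And>x. f x = (\<Sum>m\<le>2. \<Sum>n\<le>2 - m. c m n (x $ 1, x $ 2) * (x $ 3) ^ m * (x $ 4) ^ n)"
    unfolding quadratic_in_p_def by blast
  define c' where "c' m = (case m of M20 \<Rightarrow> c 2 0 | M11 \<Rightarrow> c 1 1 | M02 \<Rightarrow> c 0 2
    | M10 \<Rightarrow> c 1 0 | M01 \<Rightarrow> c 0 1 | M00 \<Rightarrow> c 0 0)" for m
  have "smooth (c' m)" for m by (cases m) (simp_all add: c'_def sm)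
  moreover have "f x = quad c' (x $ 1, x $ 2) (x $ 3) (x $ 4)" for x
    unfolding f quad_def c'_def by (simp add: numeral_2_eq_2)
  ultimately show "\<exists>c. (\<forall>m. smooth (c m)) \<and> (\<forall>x. f x = quad c (x $ 1, x $ 2) (x $ 3) (x $ 4))"
    by blast
next
  assume "\<exists>c. (\<forall>m. smooth (c m)) \<and> (\<forall>x. f x = quad c (x $ 1, x $ 2) (x $ 3) (x $ 4))"
  then obtain c where sm: "\<And>m. smooth (c m)" and f: "\<And>x. f x = quad c (x $ 1, x $ 2) (x $ 3) (x $ 4)"
    by blast
  define c' where "c' m n = (if m = 2 then c M20 else if m = 1 then (if n = 1 then c M11 else c M10)
    else if n = 2 then c M02 else if n = 1 then c M01 else c M00)" for m n :: nat
  have "smooth (c' m n)" for m n by (simp add: c'_def sm)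
  moreover have "f x = (\<Sum>m\<le>2. \<Sum>n\<le>2 - m. c' m n (x $ 1, x $ 2) * (x $ 3) ^ m * (x $ 4) ^ n)" for x
    unfolding f quad_def c'_def by (simp add: numeral_2_eq_2)
  ultimately show "quadratic_in_p f" unfolding quadratic_in_p_def by blast
qed

lemma quadratic_in_p_add:
  assumes "quadratic_in_p f" "quadratic_in_p g"
  shows "quadratic_in_p (\<lambda>x. f x + g x)"
proof -
  obtain c c' where c: "\<And>m. smooth (c m)" "\<And>x. f x = quad c (x $ 1, x $ 2) (x $ 3) (x $ 4)"
    and c': "\<And>m. smooth (c' m)" "\<And>x. g x = quad c' (x $ 1, x $ 2) (x $ 3) (x $ 4)"
    using assms unfolding quadratic_in_p_iff by blast
  show ?thesis unfolding quadratic_in_p_iff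
    by (intro exI[of _ "\<lambda>m z. c m z + c' m z"]) (simp add: c c' smooth_add quad_def algebra_simps)
qed

lemma quadratic_in_p_scale:
  assumes "quadratic_in_p f"
  shows "quadratic_in_p (\<lambda>x. k * f x)"
proof -
  obtain c where c: "\<And>m. smooth (c m)" "\<And>x. f x = quad c (x $ 1, x $ 2) (x $ 3) (x $ 4)"
    using assms unfolding quadratic_in_p_iff by blast
  show ?thesis unfolding quadratic_in_p_iff
    by (intro exI[of _ "\<lambda>m z. k * c m z"]) (simp add: c smooth_scale quad_def algebra_simps)
qed

lemma quadratic_in_p_monomial:
  assumes "smooth g"
  shows "quadratic_in_p (\<lambda>x. g (x $ 1, x $ 2))" "quadratic_in_p (\<lambda>x. g (x $ 1, x $ 2) * x $ 3)"
    "quadratic_in_p (\<lambda>x. g (x $ 1, x $ 2) * x $ 4)" "quadratic_in_p (\<lambda>x. g (x $ 1, x $ 2) * (x $ 3)\<^sup>2)"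
    "quadratic_in_p (\<lambda>x. g (x $ 1, x $ 2) * (x $ 3 * x $ 4))" "quadratic_in_p (\<lambda>x. g (x $ 1, x $ 2) * (x $ 4)\<^sup>2)"
proof -
  have "quadratic_in_p (\<lambda>x. quad (\<lambda>m z. if m = n then g z else 0) (x $ 1, x $ 2) (x $ 3) (x $ 4))" for n
    unfolding quadratic_in_p_iff
  proof (intro exI conjI allI)
    show "smooth (\<lambda>z. if m = n then g z else 0)" for m using assms smooth_const[of 0] by (cases "m = n") simp_all
  qed simp
  from this[of M00] this[of M10] this[of M01] this[of M20] this[of M11] this[of M02]
  show "quadratic_in_p (\<lambda>x. g (x $ 1, x $ 2))" "quadratic_in_p (\<lambda>x. g (x $ 1, x $ 2) * x $ 3)"
    "quadratic_in_p (\<lambda>x. g (x $ 1, x $ 2) * x $ 4)" "quadratic_in_p (\<lambda>x. g (x $ 1, x $ 2) * (x $ 3)\<^sup>2)"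
    "quadratic_in_p (\<lambda>x. g (x $ 1, x $ 2) * (x $ 3 * x $ 4))" "quadratic_in_p (\<lambda>x. g (x $ 1, x $ 2) * (x $ 4)\<^sup>2)"
    by (simp_all add: quad_def)
qed

lemma quadratic_in_p_differentiable:
  assumes "quadratic_in_p f"
  shows "f differentiable at x"
proof -
  obtain c where c: "\<And>m. smooth (c m)" and f: "\<And>x. f x = quad c (x $ 1, x $ 2) (x $ 3) (x $ 4)"
    using assms unfolding quadratic_in_p_iff by blast
  have "((\<lambda>x::real^4. (x $ 1, x $ 2)) has_derivative (\<lambda>h. (h $ 1, h $ 2))) (at x)"
    by (intro has_derivative_Pair has_derivative_vec_nth)
  then have "(\<lambda>x::real^4. c m (x $ 1, x $ 2)) differentiable at x" for m
    using has_derivative_compose[OF _ smooth_has_derivative[OF c]] unfolding differentiable_def by blast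
  moreover have "(\<lambda>x::real^4. x $ i) differentiable at x" for i
    using has_derivative_vec_nth differentiableI by blast
  ultimately have "(\<lambda>x. quad c (x $ 1, x $ 2) (x $ 3) (x $ 4)) differentiable at x"
    unfolding quad_def by (intro differentiable_add differentiable_mult differentiable_power)
  moreover have "f = (\<lambda>x. quad c (x $ 1, x $ 2) (x $ 3) (x $ 4))" using f by blast
  ultimately show ?thesis by simp
qed

text \<open>Linear coordinates in which \<open>E1 = exp u\<close>, \<open>E2 = exp v\<close>, and in which the structure constants
  of the equations are rational; \<open>r, s\<close> are the velocities of \<open>u, v\<close>.\<close>

definition phase_point :: "real \<Rightarrow> real \<Rightarrow> real \<Rightarrow> real \<Rightarrow> real^4" where
  "phase_point u v r s = vector [sqrt 3 * u, 3 * u + 2 * v, sqrt 3 * r, 3 * r + 2 * s]"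

lemma phase_point_nth [simp]:
  "phase_point u v r s $ 1 = sqrt 3 * u" "phase_point u v r s $ 2 = 3 * u + 2 * v"
  "phase_point u v r s $ 3 = sqrt 3 * r" "phase_point u v r s $ 4 = 3 * r + 2 * s"
  by (simp_all add: phase_point_def)

lemma phase_point_surj: "\<exists>u v r s. x = phase_point u v r s"
  by (rule exI[of _ "x $ 1 / sqrt 3"], rule exI[of _ "(x $ 2 - 3 * (x $ 1 / sqrt 3)) / 2"],
      rule exI[of _ "x $ 3 / sqrt 3"], rule exI[of _ "(x $ 4 - 3 * (x $ 3 / sqrt 3)) / 2"])
    (simp add: vec_eq_iff forall_4 diff_divide_distrib)

lemma potential_phase_point:
  "E1 (phase_point u v r s) = exp u" "E2 (phase_point u v r s) = exp v"
  "exp (- (phase_point u v r s $ 2)) = exp (- 3 * u - 2 * v)"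
  by (simp_all add: E1_def E2_def field_simps)

lemma quadratic_in_p_phase_point:
  assumes "quadratic_in_p f"
  obtains c where "\<And>m. smooth (c m)" "\<And>u v r s. f (phase_point u v r s) = quad c (u, v) r s"
proof -
  obtain c where c: "\<And>m. smooth (c m)" and f: "\<And>x. f x = quad c (x $ 1, x $ 2) (x $ 3) (x $ 4)"
    using assms unfolding quadratic_in_p_iff by blast
  define L :: "real \<times> real \<Rightarrow> real \<times> real" where "L z = (sqrt 3 * fst z, 3 * fst z + 2 * snd z)" for z
  have L: "linear L" by (intro linearI) (simp_all add: L_def algebra_simps)
  note cL = smooth_compose_linear[OF L c]
  \<comment> \<open>Coefficients after substituting \<open>sqrt 3 * r\<close> and
    \<open>3 * r + 2 * s\<close> for the momenta.\<close>
  define c' where "c' m z = (case m of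
      M20 \<Rightarrow> 3 * c M20 (L z) + (3 * sqrt 3 * c M11 (L z) + 9 * c M02 (L z))
    | M11 \<Rightarrow> 2 * sqrt 3 * c M11 (L z) + 12 * c M02 (L z)
    | M02 \<Rightarrow> 4 * c M02 (L z)
    | M10 \<Rightarrow> sqrt 3 * c M10 (L z) + 3 * c M01 (L z)
    | M01 \<Rightarrow> 2 * c M01 (L z)
    | M00 \<Rightarrow> c M00 (L z))" for m z
  have "smooth (c' m)" for m
    by (cases m) (auto simp: c'_def[abs_def] intro!: smooth_add smooth_scale cL)
  moreover have "f (phase_point u v r s) = quad c' (u, v) r s" for u v r s
    by (simp add: f quad_def c'_def L_def power_mult_distrib power2_sum) (simp add: algebra_simps power2_eq_square)
  ultimately show thesis using that by blast
qed

section \<open>Derivatives along the flow in the adapted coordinates\<close>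

lemma cubic_coeffs_zero:
  fixes k30 :: real
  assumes "\<And>r s. k30 * r ^ 3 + k21 * (r\<^sup>2 * s) + k12 * (r * s\<^sup>2) + k03 * s ^ 3
    + k20 * r\<^sup>2 + k11 * (r * s) + k02 * s\<^sup>2 + k10 * r + k01 * s + k00 = 0"
  shows "k30 = 0" "k21 = 0" "k12 = 0" "k03 = 0" "k20 = 0" "k11 = 0" "k02 = 0" "k10 = 0" "k01 = 0" "k00 = 0"
proof -
  have 0: "k00 = 0" using assms[of 0 0] by simp
  have r: "k30 = 0" "k20 = 0" "k10 = 0"
    using assms[of 1 0] assms[of "-1" 0] assms[of 2 0] 0 by simp_all
  have s: "k03 = 0" "k02 = 0" "k01 = 0"
    using assms[of 0 1] assms[of 0 "-1"] assms[of 0 2] 0 by simp_all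
  have "k21 = 0" "k12 = 0" "k11 = 0"
    using assms[of 1 1] assms[of 1 "-1"] assms[of 2 1] 0 r s by simp_all
  with 0 r s show "k30 = 0" "k21 = 0" "k12 = 0" "k03 = 0" "k20 = 0" "k11 = 0" "k02 = 0" "k10 = 0" "k01 = 0" "k00 = 0"
    by simp_all
qed

text \<open>Linearity of the coordinates turns the line through the point in direction of the field
  into a line with direction \<open>(r, s, - F1, - F2)\<close>. Differentiating \<open>f\<close>
  along it at 0 in both descriptions gives the formula.\<close>

lemma XD_phase_point:
  assumes f: "f differentiable at (phase_point u v r s)"
    and c: "\<And>m. smooth (c m)" "\<And>u v r s. f (phase_point u v r s) = quad c (u, v) r s"
  shows "XD \<alpha> f (phase_point u v r s) =
    r * quad (\<lambda>m. du (c m)) (u, v) r s + s * quad (\<lambda>m. dv (c m)) (u, v) r s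
    - force1 u v * (2 * c M20 (u, v) * r + c M11 (u, v) * s + c M10 (u, v))
    - force2 \<alpha> u v * (c M11 (u, v) * r + 2 * c M02 (u, v) * s + c M01 (u, v))"
proof -
  let ?x = "phase_point u v r s" and ?X = "toda_X \<alpha> (phase_point u v r s)"
  define F1 F2 where "F1 = force1 u v" "F2 = force2 \<alpha> u v"
  have X: "?x + t *\<^sub>R ?X = phase_point (u + t * r) (v + t * s) (r + t * - F1) (s + t * - F2)" for t
    by (simp add: vec_eq_iff forall_4 toda_X_nth V1_def V2_def potential_phase_point
        F1_F2_def force1_def force2_def divide_sqrt_3 field_simps)
  have "((\<lambda>t. ?x + t *\<^sub>R ?X) has_derivative (\<lambda>t. t *\<^sub>R ?X)) (at 0)"
    by (auto intro!: derivative_eq_intros)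
  moreover have "(f has_derivative frechet_derivative f (at ?x)) (at (?x + 0 *\<^sub>R ?X))"
    using f by (simp add: frechet_derivative_works)
  ultimately have "((\<lambda>t. f (?x + t *\<^sub>R ?X)) has_derivative (\<lambda>t. frechet_derivative f (at ?x) (t *\<^sub>R ?X))) (at 0)"
    by (rule has_derivative_compose)
  moreover have "frechet_derivative f (at ?x) (t *\<^sub>R ?X) = XD \<alpha> f ?x * t" for t
    using linear_cmul[OF linear_frechet_derivative[OF f]] by (simp add: XD_def)
  ultimately have 1: "((\<lambda>t. quad c (u + t * r, v + t * s) (r + t * - F1) (s + t * - F2)) has_real_derivative XD \<alpha> f ?x) (at 0)"
    by (simp only: has_field_derivative_def X c)
  have 2: "((\<lambda>t. c m (u + t * r, v + t * s)) has_real_derivative r * du (c m) (u, v) + s * dv (c m) (u, v)) (at 0)" for m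
    using smooth_DERIV_line[OF c(1)[of m], of u r v s 0] by simp
  have "((\<lambda>t. quad c (u + t * r, v + t * s) (r + t * - F1) (s + t * - F2)) has_real_derivative
     r * quad (\<lambda>m. du (c m)) (u, v) r s + s * quad (\<lambda>m. dv (c m)) (u, v) r s
    - F1 * (2 * c M20 (u, v) * r + c M11 (u, v) * s + c M10 (u, v))
    - F2 * (c M11 (u, v) * r + 2 * c M02 (u, v) * s + c M01 (u, v))) (at 0)"
    unfolding quad_def
    by (rule derivative_eq_intros 2 refl)+ (simp add: algebra_simps power2_eq_square)
  with 1 show ?thesis unfolding F1_F2_def by (rule DERIV_unique)
qed

lemma flow_eqI:
  assumes f: "\<And>x. f differentiable at x"
    and c: "\<And>m. smooth (c m)" "\<And>u v r s. f (phase_point u v r s) = quad c (u, v) r s"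
    and X: "\<And>u v r s. XD \<alpha> f (phase_point u v r s) = quad (\<lambda>m z. h m (fst z) (snd z)) (u, v) r s"
  shows "flow_eq \<alpha> c h"
  unfolding flow_eq_def
proof (intro allI)
  fix u v
  let ?c = "\<lambda>m. c m (u, v)" and ?u = "\<lambda>m. du (c m) (u, v)" and ?v = "\<lambda>m. dv (c m) (u, v)" and ?h = "\<lambda>m. h m u v"
  have "?u M20 * r ^ 3 + (?v M20 + ?u M11) * (r\<^sup>2 * s) + (?v M11 + ?u M02) * (r * s\<^sup>2) + ?v M02 * s ^ 3
    + (?u M10 - ?h M20) * r\<^sup>2 + (?v M10 + ?u M01 - ?h M11) * (r * s) + (?v M01 - ?h M02) * s\<^sup>2
    + (?u M00 - 2 * force1 u v * ?c M20 - force2 \<alpha> u v * ?c M11 - ?h M10) * r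
    + (?v M00 - force1 u v * ?c M11 - 2 * force2 \<alpha> u v * ?c M02 - ?h M01) * s
    + (- force1 u v * ?c M10 - force2 \<alpha> u v * ?c M01 - ?h M00) = 0" for r s
    using XD_phase_point[OF f c, of \<alpha> u v r s] X[of u v r s]
    by (simp add: quad_def algebra_simps power2_eq_square power3_eq_cube)
  from cubic_coeffs_zero[OF this]
  show "?u M20 = 0 \<and> ?v M20 + ?u M11 = 0 \<and> ?v M11 + ?u M02 = 0 \<and> ?v M02 = 0 \<and>
     ?u M10 = ?h M20 \<and> ?v M10 + ?u M01 = ?h M11 \<and> ?v M01 = ?h M02 \<and>
     ?u M00 = ?h M10 + 2 * force1 u v * ?c M20 + force2 \<alpha> u v * ?c M11 \<and>
     ?v M00 = ?h M01 + force1 u v * ?c M11 + 2 * force2 \<alpha> u v * ?c M02 \<and>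
     force1 u v * ?c M10 + force2 \<alpha> u v * ?c M01 + ?h M00 = 0"
    by simp
qed

lemma invariant_bivectorsD:
  assumes "B \<in> invariant_bivectors \<alpha>"
  shows "bivector_field B" "quadratic_in_p (\<lambda>x. B x $ i $ j)" "(\<lambda>x. B x $ i $ j) differentiable at x"
    "lie_bivector (toda_X \<alpha>) B x = 0"
  using assms quadratic_in_p_differentiable
  by (auto simp: invariant_bivectors_def quadratic_bivector_fields_def)

lemma invariant_bivectors_XD:
  assumes B: "B \<in> invariant_bivectors \<alpha>"
  shows "XD \<alpha> (\<lambda>y. B y $ 1 $ 2) x = B x $ 1 $ 4 - B x $ 2 $ 3"
    "XD \<alpha> (\<lambda>y. B y $ 1 $ 3) x = - B x $ 1 $ 2 * W12 x"
    "XD \<alpha> (\<lambda>y. B y $ 1 $ 4) x = B x $ 3 $ 4 - B x $ 1 $ 2 * W22 \<alpha> x"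
    "XD \<alpha> (\<lambda>y. B y $ 2 $ 3) x = - B x $ 3 $ 4 + B x $ 1 $ 2 * W11 x"
    "XD \<alpha> (\<lambda>y. B y $ 2 $ 4) x = B x $ 1 $ 2 * W12 x"
    "XD \<alpha> (\<lambda>y. B y $ 3 $ 4) x = B x $ 1 $ 3 * W12 x + B x $ 2 $ 3 * W22 \<alpha> x
      - B x $ 1 $ 4 * W11 x - B x $ 2 $ 4 * W12 x"
  using lie_bivector_toda_eq_0_iff[OF invariant_bivectorsD(1,3)[OF B]] invariant_bivectorsD(4)[OF B, of x]
  by auto

text \<open>The functionals in the hypotheses read off the parameters of \<open>canonical_P\<close>,
  \<open>toda_H \<alpha> x *\<^sub>R canonical_P\<close> and \<open>P_tilde\<close>; for \<open>\<alpha> \<noteq> 0\<close> the last one vanishes by itself.\<close>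

lemma invariant_bivectors_kernel:
  assumes B: "B \<in> invariant_bivectors \<alpha>"
    and k: "B (phase_point 0 0 0 0) $ 1 $ 3 = 0"
      "B (phase_point 0 0 0 1) $ 1 $ 3 + B (phase_point 0 0 0 (-1)) $ 1 $ 3 = 0"
      "B (phase_point 0 0 0 1) $ 1 $ 2 = B (phase_point 0 0 0 (-1)) $ 1 $ 2 \<or> \<alpha> \<noteq> 0"
  shows "B x = 0"
proof -
  note diff = invariant_bivectorsD(3)[OF B] and quad = invariant_bivectorsD(2)[OF B]
  \<comment> \<open>The entries of \<open>B\<close> on the differentials of \<open>u\<close>,
    \<open>v\<close>, \<open>r\<close>, \<open>s\<close>; for instance \<open>f12\<close> pairs
    \<open>u\<close> with \<open>s\<close>. The factor \<open>sqrt 3 / 6\<close> in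
    \<open>fa\<close> and \<open>fd\<close> is the determinant of the change of positions.\<close>
  define fa where "fa x = sqrt 3 / 6 * B x $ 1 $ 2" for x
  define f11 where "f11 x = 1 / 3 * B x $ 1 $ 3" for x
  define f12 where "f12 x = sqrt 3 / 6 * B x $ 1 $ 4 + (- 1 / 2) * B x $ 1 $ 3" for x
  define f21 where "f21 x = sqrt 3 / 6 * B x $ 2 $ 3 + (- 1 / 2) * B x $ 1 $ 3" for x
  define f22 where "f22 x = 1 / 4 * B x $ 2 $ 4 + (3 / 4 * B x $ 1 $ 3
    + ((- sqrt 3 / 4) * B x $ 1 $ 4 + (- sqrt 3 / 4) * B x $ 2 $ 3))" for x
  define fd where "fd x = sqrt 3 / 6 * B x $ 3 $ 4" for x
  note f_defs = fa_def f11_def f12_def f21_def f22_def fd_def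
  have q: "quadratic_in_p fa" "quadratic_in_p f11" "quadratic_in_p f12" "quadratic_in_p f21"
    "quadratic_in_p f22" "quadratic_in_p fd"
    unfolding f_defs[abs_def] by (intro quadratic_in_p_add quadratic_in_p_scale quad)+
  note qd = q[THEN quadratic_in_p_differentiable]
  obtain a where a: "\<And>m. smooth (a m)" "\<And>u v r s. fa (phase_point u v r s) = quad a (u, v) r s"
    using quadratic_in_p_phase_point[OF q(1)] by blast
  obtain c11 where c11: "\<And>m. smooth (c11 m)" "\<And>u v r s. f11 (phase_point u v r s) = quad c11 (u, v) r s"
    using quadratic_in_p_phase_point[OF q(2)] by blast
  obtain c12 where c12: "\<And>m. smooth (c12 m)" "\<And>u v r s. f12 (phase_point u v r s) = quad c12 (u, v) r s"
    using quadratic_in_p_phase_point[OF q(3)] by blast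
  obtain c21 where c21: "\<And>m. smooth (c21 m)" "\<And>u v r s. f21 (phase_point u v r s) = quad c21 (u, v) r s"
    using quadratic_in_p_phase_point[OF q(4)] by blast
  obtain c22 where c22: "\<And>m. smooth (c22 m)" "\<And>u v r s. f22 (phase_point u v r s) = quad c22 (u, v) r s"
    using quadratic_in_p_phase_point[OF q(5)] by blast
  obtain d where d: "\<And>m. smooth (d m)" "\<And>u v r s. fd (phase_point u v r s) = quad d (u, v) r s"
    using quadratic_in_p_phase_point[OF q(6)] by blast
  note c = a(2) c11(2) c12(2) c21(2) c22(2) d(2)
  note eqs = invariant_bivectors_XD[OF B]
  note dd = diff differentiable_add differentiable_mult differentiable_const
  have sq: "sqrt 3 * (sqrt 3 * t) = 3 * t" for t by simp
  have XDf: "XD \<alpha> fa x = sqrt 3 / 6 * XD \<alpha> (\<lambda>y. B y $ 1 $ 2) x"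
    "XD \<alpha> f11 x = 1 / 3 * XD \<alpha> (\<lambda>y. B y $ 1 $ 3) x"
    "XD \<alpha> f12 x = sqrt 3 / 6 * XD \<alpha> (\<lambda>y. B y $ 1 $ 4) x + (- 1 / 2) * XD \<alpha> (\<lambda>y. B y $ 1 $ 3) x"
    "XD \<alpha> f21 x = sqrt 3 / 6 * XD \<alpha> (\<lambda>y. B y $ 2 $ 3) x + (- 1 / 2) * XD \<alpha> (\<lambda>y. B y $ 1 $ 3) x"
    "XD \<alpha> f22 x = 1 / 4 * XD \<alpha> (\<lambda>y. B y $ 2 $ 4) x + (3 / 4 * XD \<alpha> (\<lambda>y. B y $ 1 $ 3) x
      + ((- sqrt 3 / 4) * XD \<alpha> (\<lambda>y. B y $ 1 $ 4) x + (- sqrt 3 / 4) * XD \<alpha> (\<lambda>y. B y $ 2 $ 3) x))"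
    "XD \<alpha> fd x = sqrt 3 / 6 * XD \<alpha> (\<lambda>y. B y $ 3 $ 4) x" for x
    unfolding f_defs[abs_def] by (simp_all only: XD_add XD_scale dd)
  have X: "XD \<alpha> fa x = f12 x - f21 x"
    "XD \<alpha> f11 x = E2 x / 2 * fa x"
    "XD \<alpha> f12 x = fd x - (E2 x + \<alpha> * exp (- (x $ 2))) * fa x"
    "XD \<alpha> f21 x = - fd x + E1 x / 3 * fa x"
    "XD \<alpha> f22 x = - (E1 x / 2 - 3 / 2 * \<alpha> * exp (- (x $ 2))) * fa x"
    "XD \<alpha> fd x = - E1 x * (f11 x / 2 + f12 x / 3) + E2 x * (f21 x + f22 x / 2)
      + \<alpha> * exp (- (x $ 2)) * (3 * f11 x + 2 * f21 x) / 2" for x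
    unfolding XDf eqs f_defs W11_def W12_def W22_def by (simp_all add: field_simps sq)
  interpret toda: toda_system \<alpha> a c11 c12 c21 c22 d
  proof
    show "smooth (a m)" "smooth (c11 m)" "smooth (c12 m)" "smooth (c21 m)" "smooth (c22 m)" "smooth (d m)" for m
      by (fact a c11 c12 c21 c22 d)+
  qed (rule flow_eqI[OF qd(1) a] flow_eqI[OF qd(2) c11] flow_eqI[OF qd(3) c12] flow_eqI[OF qd(4) c21]
      flow_eqI[OF qd(5) c22] flow_eqI[OF qd(6) d];
      simp only: X potential_phase_point c; simp add: quad_def algebra_simps add_divide_distrib)+
  have "c11 M00 (0, 0) = 0" using k(1) c11(2)[of 0 0 0 0] by (simp add: f11_def quad_def)
  moreover have "c11 M02 (0, 0) = 0"
    using k(1,2) c11(2)[of 0 0 0 0] c11(2)[of 0 0 0 1] c11(2)[of 0 0 0 "-1"] by (simp add: f11_def quad_def)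
  moreover have "a M01 (0, 0) = 0 \<or> \<alpha> \<noteq> 0"
    using k(3) a(2)[of 0 0 0 1] a(2)[of 0 0 0 "-1"] by (auto simp: fa_def quad_def)
  ultimately have zero: "a m z = 0" "c11 m z = 0" "c12 m z = 0" "c21 m z = 0" "c22 m z = 0" "d m z = 0" for m z
    using toda.all_zero by blast+
  obtain u v r s where x: "x = phase_point u v r s" using phase_point_surj by blast
  have "fa x = 0" "f11 x = 0" "f12 x = 0" "f21 x = 0" "f22 x = 0" "fd x = 0"
    unfolding x c by (simp_all add: quad_def zero)
  then have upper: "B x $ 1 $ 2 = 0" "B x $ 1 $ 3 = 0" "B x $ 1 $ 4 = 0" "B x $ 2 $ 3 = 0" "B x $ 2 $ 4 = 0" "B x $ 3 $ 4 = 0"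
    by (simp_all add: f_defs)
  have skew: "B x $ i $ j = - B x $ j $ i" for i j
    using invariant_bivectorsD(1)[OF B] unfolding bivector_field_def by blast
  show ?thesis
    using upper skew[of 1 1] skew[of 2 2] skew[of 3 3] skew[of 4 4] skew[of 2 1] skew[of 3 1]
      skew[of 4 1] skew[of 3 2] skew[of 4 2] skew[of 4 3]
    by (simp add: vec_eq_iff forall_4)
qed

lemma invariant_bivectors_linear:
  assumes B: "B \<in> invariant_bivectors \<alpha>" and C: "C \<in> invariant_bivectors \<alpha>"
  shows "(\<lambda>x. b *\<^sub>R B x + c *\<^sub>R C x) \<in> invariant_bivectors \<alpha>"
proof -
  note BD = invariant_bivectorsD[OF B] and CD = invariant_bivectorsD[OF C]
  let ?S = "\<lambda>x. b *\<^sub>R B x + c *\<^sub>R C x"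
  have nth: "?S x $ i $ j = b * B x $ i $ j + c * C x $ i $ j" for x i j by simp
  have sk: "bivector_field ?S"
    unfolding bivector_field_def nth
  proof (intro allI)
    fix x i j
    have "B x $ i $ j = - B x $ j $ i" "C x $ i $ j = - C x $ j $ i"
      using BD(1) CD(1) unfolding bivector_field_def by blast+
    then show "b * B x $ i $ j + c * C x $ i $ j = - (b * B x $ j $ i + c * C x $ j $ i)" by simp
  qed
  have q: "quadratic_in_p (\<lambda>x. ?S x $ i $ j)" for i j
    unfolding nth by (intro quadratic_in_p_add quadratic_in_p_scale BD CD)
  have XD: "XD \<alpha> (\<lambda>y. b * B y $ i $ j + c * C y $ i $ j) x = b * XD \<alpha> (\<lambda>y. B y $ i $ j) x + c * XD \<alpha> (\<lambda>y. C y $ i $ j) x" for i j x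
    by (simp only: XD_add XD_scale BD(3) CD(3) differentiable_mult differentiable_const)
  have "lie_bivector (toda_X \<alpha>) ?S x = 0" for x
    unfolding lie_bivector_toda_eq_0_iff[OF sk quadratic_in_p_differentiable[OF q]] nth XD
      invariant_bivectors_XD[OF B] invariant_bivectors_XD[OF C]
    by (simp add: algebra_simps)
  then show ?thesis
    using sk q by (simp add: invariant_bivectors_def quadratic_bivector_fields_def)
qed

section \<open>Invariance of the claimed families\<close>

lemma bivector4_nth:
  "bivector4 b12 b13 b14 b23 b24 b34 $ 1 $ 2 = b12" "bivector4 b12 b13 b14 b23 b24 b34 $ 1 $ 3 = b13"
  "bivector4 b12 b13 b14 b23 b24 b34 $ 1 $ 4 = b14" "bivector4 b12 b13 b14 b23 b24 b34 $ 2 $ 3 = b23"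
  "bivector4 b12 b13 b14 b23 b24 b34 $ 2 $ 4 = b24" "bivector4 b12 b13 b14 b23 b24 b34 $ 3 $ 4 = b34"
  "bivector4 b12 b13 b14 b23 b24 b34 $ 2 $ 1 = - b12" "bivector4 b12 b13 b14 b23 b24 b34 $ 3 $ 1 = - b13"
  "bivector4 b12 b13 b14 b23 b24 b34 $ 4 $ 1 = - b14" "bivector4 b12 b13 b14 b23 b24 b34 $ 3 $ 2 = - b23"
  "bivector4 b12 b13 b14 b23 b24 b34 $ 4 $ 2 = - b24" "bivector4 b12 b13 b14 b23 b24 b34 $ 4 $ 3 = - b34"
  "bivector4 b12 b13 b14 b23 b24 b34 $ 1 $ 1 = 0" "bivector4 b12 b13 b14 b23 b24 b34 $ 2 $ 2 = 0"
  "bivector4 b12 b13 b14 b23 b24 b34 $ 3 $ 3 = 0" "bivector4 b12 b13 b14 b23 b24 b34 $ 4 $ 4 = 0"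
  by (simp_all add: bivector4_def)

lemma bivector4_invariant:
  assumes q: "quadratic_in_p b12" "quadratic_in_p b13" "quadratic_in_p b14" "quadratic_in_p b23"
      "quadratic_in_p b24" "quadratic_in_p b34"
    and X: "\<And>x. XD \<alpha> b12 x = b14 x - b23 x" "\<And>x. XD \<alpha> b13 x = - b12 x * W12 x"
      "\<And>x. XD \<alpha> b14 x = b34 x - b12 x * W22 \<alpha> x" "\<And>x. XD \<alpha> b23 x = - b34 x + b12 x * W11 x"
      "\<And>x. XD \<alpha> b24 x = b12 x * W12 x"
      "\<And>x. XD \<alpha> b34 x = b13 x * W12 x + b23 x * W22 \<alpha> x - b14 x * W11 x - b24 x * W12 x"
  shows "(\<lambda>x. bivector4 (b12 x) (b13 x) (b14 x) (b23 x) (b24 x) (b34 x)) \<in> invariant_bivectors \<alpha>" (is "?B \<in> _")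
proof -
  have sk: "bivector_field ?B" by (simp add: bivector_field_def forall_4 bivector4_nth)
  have "quadratic_in_p (\<lambda>x. 0)" using quadratic_in_p_scale[OF q(1), of 0] by simp
  moreover have "quadratic_in_p (\<lambda>x. - b x)" if "quadratic_in_p b" for b
    using quadratic_in_p_scale[OF that, of "-1"] by simp
  ultimately have "\<forall>i j. quadratic_in_p (\<lambda>x. ?B x $ i $ j)"
    unfolding forall_4 bivector4_nth using q by blast
  then have quad: "quadratic_in_p (\<lambda>x. ?B x $ i $ j)" for i j by blast
  have "lie_bivector (toda_X \<alpha>) ?B x = 0" for x
    unfolding lie_bivector_toda_eq_0_iff[OF sk quadratic_in_p_differentiable[OF quad]] bivector4_nth
    by (simp add: X)
  then show ?thesis using sk quad by (simp add: invariant_bivectors_def quadratic_bivector_fields_def)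
qed

lemma quadratic_in_p_basic:
  "quadratic_in_p (\<lambda>x. k)" "quadratic_in_p (\<lambda>x. x $ 3)" "quadratic_in_p (\<lambda>x. x $ 4)"
  "quadratic_in_p (\<lambda>x. (x $ 3)\<^sup>2)" "quadratic_in_p (\<lambda>x. x $ 3 * x $ 4)" "quadratic_in_p (\<lambda>x. (x $ 4)\<^sup>2)"
  using quadratic_in_p_monomial(1)[OF smooth_const[of k]] quadratic_in_p_monomial[OF smooth_const[of 1]] by simp_all

lemma quadratic_in_p_exp:
  "quadratic_in_p (\<lambda>x. exp (a * x $ 1 + b * x $ 2))" "quadratic_in_p (\<lambda>x. exp (a * x $ 1 + b * x $ 2) * x $ 3)"
  "quadratic_in_p (\<lambda>x. exp (a * x $ 1 + b * x $ 2) * x $ 4)"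
proof -
  have "linear (\<lambda>z::real \<times> real. a * fst z + b * snd z)"
    by (intro linearI) (simp_all add: algebra_simps)
  then have "smooth (\<lambda>z::real \<times> real. exp (a * fst z + b * snd z))" by (rule smooth_exp_linear)
  from quadratic_in_p_monomial[OF this]
  show "quadratic_in_p (\<lambda>x. exp (a * x $ 1 + b * x $ 2))" "quadratic_in_p (\<lambda>x. exp (a * x $ 1 + b * x $ 2) * x $ 3)"
  "quadratic_in_p (\<lambda>x. exp (a * x $ 1 + b * x $ 2) * x $ 4)" by simp_all
qed

lemma quadratic_in_p_E:
  "quadratic_in_p E1" "quadratic_in_p (\<lambda>x. E1 x * x $ 3)" "quadratic_in_p (\<lambda>x. E1 x * x $ 4)"
  "quadratic_in_p E2" "quadratic_in_p (\<lambda>x. E2 x * x $ 3)" "quadratic_in_p (\<lambda>x. E2 x * x $ 4)"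
  "quadratic_in_p (\<lambda>x. exp (- (x $ 2)))"
proof -
  have E: "E1 = (\<lambda>x. exp (1 / sqrt 3 * x $ 1 + 0 * x $ 2))" "E2 = (\<lambda>x. exp (- (sqrt 3 / 2) * x $ 1 + 1 / 2 * x $ 2))"
    by (simp_all add: E1_def E2_def fun_eq_iff)
  show "quadratic_in_p E1" "quadratic_in_p (\<lambda>x. E1 x * x $ 3)" "quadratic_in_p (\<lambda>x. E1 x * x $ 4)"
    "quadratic_in_p E2" "quadratic_in_p (\<lambda>x. E2 x * x $ 3)" "quadratic_in_p (\<lambda>x. E2 x * x $ 4)"
    unfolding E by (rule quadratic_in_p_exp)+
  show "quadratic_in_p (\<lambda>x. exp (- (x $ 2)))" using quadratic_in_p_exp(1)[of 0 "-1"] by simp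
qed

lemma quadratic_in_p_toda_H: "quadratic_in_p (toda_H \<alpha>)"
proof -
  have "quadratic_in_p (\<lambda>x. 1 / 2 * (x $ 3)\<^sup>2 + (1 / 2 * (x $ 4)\<^sup>2 + (E1 x + (E2 x + \<alpha> * exp (- (x $ 2))))))"
    by (intro quadratic_in_p_add quadratic_in_p_scale quadratic_in_p_basic quadratic_in_p_E)
  moreover have "(\<lambda>x. 1 / 2 * (x $ 3)\<^sup>2 + (1 / 2 * (x $ 4)\<^sup>2 + (E1 x + (E2 x + \<alpha> * exp (- (x $ 2)))))) = toda_H \<alpha>"
    by (simp add: toda_H_def fun_eq_iff add_divide_distrib)
  ultimately show ?thesis by simp
qed

lemma scaleR_canonical_P: "k *\<^sub>R canonical_P = bivector4 0 k 0 0 k 0"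
  by (simp add: canonical_P_def vec_eq_iff forall_4 bivector4_nth)

text \<open>\<open>toda_H\<close> is conserved by its own flow, and the entries of a multiple of
  \<open>canonical_P\<close> satisfy the algebraic relations identically; in the equation for the
  entry 34 the two \<open>W12\<close> terms cancel.\<close>

lemma function_of_H_times_P_invariant:
  "(\<lambda>x. (a1 * toda_H \<alpha> x + a2) *\<^sub>R canonical_P) \<in> invariant_bivectors \<alpha>"
proof -
  have q: "quadratic_in_p (\<lambda>x. a1 * toda_H \<alpha> x + a2)"
    by (intro quadratic_in_p_add quadratic_in_p_scale quadratic_in_p_toda_H quadratic_in_p_basic)
  have XH: "XD \<alpha> (\<lambda>x. a1 * toda_H \<alpha> x + a2) x = 0" for x
  proof -
    have "((\<lambda>x. a1 * toda_H \<alpha> x + a2) has_derivative (\<lambda>h. a1 * (x $ 3 * h $ 3 + x $ 4 * h $ 4 + V1 x * h $ 1 + V2 \<alpha> x * h $ 2))) (at x)"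
      by (auto intro!: derivative_eq_intros has_derivative_toda_H)
    from XD_eqI[OF this, of \<alpha>] show ?thesis by (simp add: toda_X_nth)
  qed
  have X0: "XD \<alpha> (\<lambda>x. 0) x = 0" for x by (rule XD_eqI[OF has_derivative_const])
  show ?thesis
    unfolding scaleR_canonical_P
    by (rule bivector4_invariant) (simp_all add: q quadratic_in_p_basic XH X0)
qed

lemma P_tilde_invariant: "P_tilde \<in> invariant_bivectors 0"
proof -
  define b12 b13 b14 b23 b24 b34 :: "real^4 \<Rightarrow> real"
    where "b12 x = sqrt 3 * x $ 4 + - 5 * x $ 3"
    and "b13 x = 1 / 2 * (x $ 4)\<^sup>2 + 5 / 2 * E2 x"
    and "b14 x = - 1 / 2 * (x $ 3 * x $ 4) + - sqrt 3 / 2 * E2 x"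
    and "b23 x = - 1 / 2 * (x $ 3 * x $ 4) + (- 5 * sqrt 3 / 3 * E1 x + 5 * sqrt 3 / 2 * E2 x)"
    and "b24 x = 1 / 2 * (x $ 3)\<^sup>2 + (- 3 / 2 * E2 x + E1 x)"
    and "b34 x = - 1 / 4 * (E2 x * x $ 3) + (sqrt 3 / 6 * (E1 x * x $ 4) + - sqrt 3 / 4 * (E2 x * x $ 4))" for x
  note defs = b12_def b13_def b14_def b23_def b24_def b34_def
  have P: "P_tilde = (\<lambda>x. bivector4 (b12 x) (b13 x) (b14 x) (b23 x) (b24 x) (b34 x))"
    by (rule ext) (simp add: P_tilde_def defs vec_eq_iff forall_4 bivector4_nth field_simps)
  have q: "quadratic_in_p b12" "quadratic_in_p b13" "quadratic_in_p b14" "quadratic_in_p b23"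
      "quadratic_in_p b24" "quadratic_in_p b34"
    unfolding defs[abs_def]
    by (intro quadratic_in_p_add quadratic_in_p_scale quadratic_in_p_basic quadratic_in_p_E)+
  have sq: "sqrt 3 * (sqrt 3 * t) = 3 * t" for t by simp
  have basic: "XD 0 (\<lambda>x. x $ 3) x = - V1 x" "XD 0 (\<lambda>x. x $ 4) x = - V2 0 x"
    "XD 0 E1 x = x $ 3 / sqrt 3 * E1 x" "XD 0 E2 x = (- (sqrt 3 / 2) * x $ 3 + x $ 4 / 2) * E2 x" for x
    using XD_eqI[OF has_derivative_vec_nth, of 0 3 x] XD_eqI[OF has_derivative_vec_nth, of 0 4 x]
      XD_eqI[OF has_derivative_E1, of 0 x] XD_eqI[OF has_derivative_E2, of 0 x]
    by (simp_all add: toda_X_nth)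
  note qd = quadratic_in_p_basic[THEN quadratic_in_p_differentiable] quadratic_in_p_E[THEN quadratic_in_p_differentiable]
    differentiable_add differentiable_mult differentiable_const
  have X: "XD 0 b12 x = b14 x - b23 x" "XD 0 b13 x = - b12 x * W12 x"
      "XD 0 b14 x = b34 x - b12 x * W22 0 x" "XD 0 b23 x = - b34 x + b12 x * W11 x"
      "XD 0 b24 x = b12 x * W12 x"
      "XD 0 b34 x = b13 x * W12 x + b23 x * W22 0 x - b14 x * W11 x - b24 x * W12 x" for x
    unfolding defs[abs_def]
    by (simp_all only: XD_add XD_scale power2_eq_square XD_mult qd basic)
      (simp_all add: W11_def W12_def W22_def V1_def V2_def divide_sqrt_3 field_simps sq)
  show ?thesis unfolding P by (rule bivector4_invariant[OF q X])
qed

section \<open>Subtracting the matching member of the family\<close>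

lemma invariant_bivectors_0:
  "invariant_bivectors 0 = {\<lambda>x. (a1 * toda_H 0 x + a2) *\<^sub>R canonical_P + a3 *\<^sub>R P_tilde x | a1 a2 a3. True}"
proof (intro set_eqI iffI)
  fix B assume "B \<in> {\<lambda>x. (a1 * toda_H 0 x + a2) *\<^sub>R canonical_P + a3 *\<^sub>R P_tilde x | a1 a2 a3. True}"
  then obtain a1 a2 a3 where "B = (\<lambda>x. (a1 * toda_H 0 x + a2) *\<^sub>R canonical_P + a3 *\<^sub>R P_tilde x)" by blast
  then show "B \<in> invariant_bivectors 0"
    using invariant_bivectors_linear[OF function_of_H_times_P_invariant[of a1 0 a2] P_tilde_invariant, of 1 a3] by simp
next
  fix B assume B: "B \<in> invariant_bivectors 0"
  let ?p = "phase_point 0 0 0"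
  \<comment> \<open>At the origin of positions, \<open>s\<close> equal to 1 or -1 means momenta 0
    and 2 or -2. The entry 12 of \<open>P_tilde\<close> then jumps by \<open>4 * sqrt 3\<close>,
    while that of \<open>canonical_P\<close> is zero.\<close>
  define a3 where "a3 = (B (?p 1) $ 1 $ 2 - B (?p (-1)) $ 1 $ 2) / (4 * sqrt 3)"
  \<comment> \<open>The second difference of the entry 13 is 4 both for H P and for
    \<open>P_tilde\<close>, so the quotient is \<open>a1 + a3\<close>.\<close>
  define a1 where "a1 = (B (?p 1) $ 1 $ 3 + B (?p (-1)) $ 1 $ 3 - 2 * B (?p 0) $ 1 $ 3) / 4 - a3"
  \<comment> \<open>At rest at the origin, \<open>toda_H 0\<close> is 2 and the entry 13 of
    \<open>P_tilde\<close> is 5/2.\<close>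
  define a2 where "a2 = B (?p 0) $ 1 $ 3 - 2 * a1 - 5 / 2 * a3"
  define C where "C x = (a1 * toda_H 0 x + a2) *\<^sub>R canonical_P + a3 *\<^sub>R P_tilde x" for x
  have C: "C \<in> invariant_bivectors 0"
    using invariant_bivectors_linear[OF function_of_H_times_P_invariant[of a1 0 a2] P_tilde_invariant, of 1 a3]
    unfolding C_def[abs_def] by simp
  have "1 *\<^sub>R B x + (-1) *\<^sub>R C x = 0" for x
    by (rule invariant_bivectors_kernel[OF invariant_bivectors_linear[OF B C]])
      (simp_all add: C_def scaleR_canonical_P P_tilde_def bivector4_nth toda_H_def potential_phase_point
        a1_def a2_def a3_def field_simps)
  then have "B = C" by (auto simp: fun_eq_iff)
  then show "B \<in> {\<lambda>x. (a1 * toda_H 0 x + a2) *\<^sub>R canonical_P + a3 *\<^sub>R P_tilde x | a1 a2 a3. True}"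
    unfolding C_def[abs_def] by blast
qed

lemma invariant_bivectors_1:
  "invariant_bivectors 1 = {\<lambda>x. (a1 * toda_H 1 x + a2) *\<^sub>R canonical_P | a1 a2. True}"
proof (intro set_eqI iffI)
  fix B assume "B \<in> {\<lambda>x. (a1 * toda_H 1 x + a2) *\<^sub>R canonical_P | a1 a2. True}"
  then show "B \<in> invariant_bivectors 1" using function_of_H_times_P_invariant by blast
next
  fix B assume B: "B \<in> invariant_bivectors 1"
  let ?p = "phase_point 0 0 0"
  define a1 where "a1 = (B (?p 1) $ 1 $ 3 + B (?p (-1)) $ 1 $ 3 - 2 * B (?p 0) $ 1 $ 3) / 4"
  \<comment> \<open>The value 3 of \<open>toda_H 1\<close> at rest at the origin is the sum of its
    three exponentials.\<close>
  define a2 where "a2 = B (?p 0) $ 1 $ 3 - 3 * a1"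
  define C where "C x = (a1 * toda_H 1 x + a2) *\<^sub>R canonical_P" for x
  have C: "C \<in> invariant_bivectors 1"
    unfolding C_def[abs_def] by (rule function_of_H_times_P_invariant)
  have "1 *\<^sub>R B x + (-1) *\<^sub>R C x = 0" for x
    by (rule invariant_bivectors_kernel[OF invariant_bivectors_linear[OF B C]])
      (simp_all add: C_def scaleR_canonical_P bivector4_nth toda_H_def potential_phase_point
        a1_def a2_def field_simps)
  then have "B = C" by (auto simp: fun_eq_iff)
  then show "B \<in> {\<lambda>x. (a1 * toda_H 1 x + a2) *\<^sub>R canonical_P | a1 a2. True}"
    unfolding C_def[abs_def] by blast
qed

theorem proposition5:
  shows "invariant_bivectors 0 =
           {\<lambda>x. (a1 * toda_H 0 x + a2) *\<^sub>R canonical_P + a3 *\<^sub>R P_tilde x | a1 a2 a3. True} \<and>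
         invariant_bivectors 1 =
           {\<lambda>x. (a1 * toda_H 1 x + a2) *\<^sub>R canonical_P | a1 a2. True}"
  using invariant_bivectors_0 invariant_bivectors_1 by blast

end
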